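(* Let $\nu>0$, $T>0$, let $\Omega\subset\mathbb{R}^d$, $d\ge2$, be a domain and let $u\in L^\infty(0,T;L^2(\Omega))\cap L^2(0,T;H^1(\Omega))$ be a Leray--Hopf weak solution to the incompressible Navier--Stokes equations with viscosity $\nu$ and pressure $p$, having non-negative local dissipation measure $D[u]\in\mathcal{M}_{\rm loc}(\Omega\times(0,T))$. Let $\alpha>0$, $3\le r,q\le\infty$ and define $$s=\min\left(d\,\frac{r-2}{r}-\alpha\frac2q,\ -1+d\,\frac{r-3}{r}+\alpha\frac{q-3}{q},\ -2+d\,\frac{r-2}{r}+\alpha\frac{q-2}{q}\right).$$ Let $K\subset\Omega\times(0,T)$ be compact and fix $\delta_0>0$ such that $\mathcal{C}^\alpha_\delta(x,t)\subset\subset\Omega\times(0,T)$ for all $(x,t)\in K$ and all $\delta\le\delta_0$. Assume that $s\ge0$, $u\in L^q_{\rm loc}(0,T;L^r_{\rm loc}(\Omega))$ and $p\in L^{q/2}_{\rm loc}(0,T;L^{r/2}_{\rm loc}(\Omega))$. Let $\mu\in\mathcal{M}_{\rm loc}(\Omega\times(0,T))$ be the positive measure $\mu=D[u]+\nu|\nabla u|^2$. Then: (i) If $q<\infty$, there exists a modulus of continuity $\omega:[0,\infty)\to[0,\infty)$ such that for every $(x,t)\in K$ $$\mu\left(\mathcal{C}^\alpha_\delta(x,t)\right)\le\omega(\delta)\,\delta^s\qquad\forall\,0<\delta\le\frac{\delta_0}{4},$$ with the convention that $s=\min\left(d-\alpha\frac2q,\ d-1+\alpha\frac{q-3}{q},\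 d-2+\alpha\frac{q-2}{q}\right)$ whenever $r=\infty$. (ii) If $q=\infty$, then for $s=\min\left(d\,\frac{r-2}{r},\ -1+d\,\frac{r-3}{r}+\alpha,\ -2+d\,\frac{r-2}{r}+\alpha\right)$ there is a constant $C$ such that for every $(x,t)\in K$ $$\mu\left(\mathcal{C}^\alpha_\delta(x,t)\right)\le C\,\delta^s\qquad\forall\,0<\delta\le\frac{\delta_0}{4},$$ with the convention that $s=\min(d,\ d-2+\alpha)$ whenever $r=\infty$. In particular, since $D[u]\ge0$, there is a constant $C'$ such that for every $(x,t)\in K$ $$\int_{\mathcal{C}^\alpha_\delta(x,t)}|\nabla u|^2\,dy\,d\tau\le C'\,\delta^s\qquad\forall\,0<\delta\le\frac{\delta_0}{4}.$$
   Context: Navier--Stokes equations: $\partial_tu+(u\cdot\nabla)u=-\nabla p+\nu\Delta u$, $\operatorname{div}u=0$ in $\Omega\times(0,T)$, with no-slip condition $u=0$ on $\partial\Omega\times(0,T)$ if $\Omega$ has a boundary (boundaries are assumed smooth). A Leray--Hopf weak solution is a distributional solution in $L^\infty(0,T;L^2(\Omega))\cap L^2(0,T;H^1(\Omega))$ (with zero trace if there is a boundary) attaining an $L^2$ divergence-free initial datum and satisfying the global energy inequality; $p$ is the associated pressure. Dissipation distribution: $D[u]$ is the distribution on $\Omega\times(0,T)$ defined by the local energy identity $$\partial_t\frac{|u|^2}{2}+\operatorname{div}\Big(\Big(\frac{|u|^2}{2}+p\Big)u\Big)-\nu\Delta\frac{|u|^2}{2}=-D[u]-\nu|\nabla u|^2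 .$$ The function $|\nabla u|^2\in L^1(\Omega\times(0,T))$ is identified with the measure having it as density with respect to space-time Lebesgue measure. $\mathcal{M}_{\rm loc}(X)$ denotes locally finite Borel (Radon) measures on $X$; $B\subset\subset X$ means that the closure of $B$ is compact and contained in $X$. $\mathcal{C}^\alpha_\delta(x,t)=B_\delta(x)\times(t-\delta^\alpha,t+\delta^\alpha)$. A modulus of continuity is a non-decreasing function $\omega:[0,\infty)\to[0,\infty)$ with $\omega(\delta)\to0$ as $\delta\to0^+$. *)

theory Defs
  imports "HOL-Analysis.Analysis" "HOL-Probability.Essential_Supremum"
begin

section \<open>Smooth functions and test functions\<close>

definition dir_deriv :: "'a::euclidean_space \<Rightarrow> ('a \<Rightarrow> real) \<Rightarrow> 'a \<Rightarrow> real" where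
  "dir_deriv v f x = frechet_derivative f (at x) v"

primrec Ck_on :: "nat \<Rightarrow> 'a::euclidean_space set \<Rightarrow> ('a \<Rightarrow> real) \<Rightarrow> bool" where
  "Ck_on 0 S f \<longleftrightarrow> continuous_on S f"
| "Ck_on (Suc k) S f \<longleftrightarrow>
     (\<forall>x\<in>S. f differentiable (at x)) \<and> (\<forall>b\<in>Basis. Ck_on k S (dir_deriv b f))"

text \<open>Meant for open \<open>S\<close> only, since the derivatives are taken in the whole space.\<close>
definition smooth_on :: "'a::euclidean_space set \<Rightarrow> ('a \<Rightarrow> real) \<Rightarrow> bool" where
  "smooth_on S f \<longleftrightarrow> (\<forall>k. Ck_on k S f)"

definition test_function :: "'a::euclidean_space set \<Rightarrow> ('a \<Rightarrow> real) \<Rightarrow> bool" where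
  "test_function S \<phi> \<longleftrightarrow> smooth_on UNIV \<phi> \<and>
     compact (closure {z. \<phi> z \<noteq> 0}) \<and> closure {z. \<phi> z \<noteq> 0} \<subseteq> S"

definition compactly_contained :: "'a::topological_space set \<Rightarrow> 'a set \<Rightarrow> bool" where
  "compactly_contained B X \<longleftrightarrow> compact (closure B) \<and> closure B \<subseteq> X"

text \<open>Local defining functions: near each boundary point the set is a strict sublevel set of a
  smooth function without critical points.  The whole space satisfies this vacuously.\<close>
definition smooth_boundary :: "'a::euclidean_space set \<Rightarrow> bool" where
  "smooth_boundary \<Omega> \<longleftrightarrow>
     (\<forall>x\<in>frontier \<Omega>. \<exists>U g. open U \<and> x \<in> U \<and> smooth_on U g \<and>
        (\<forall>y\<in>U. \<exists>b\<in>Basis. dir_deriv b g y \<noteq> 0) \<and> \<Omega> \<inter> U = {y\<in>U. g y < 0})"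


section \<open>Lebesgue and mixed Lebesgue norms\<close>

text \<open>Elements of Lebesgue spaces are represented by Borel measurable functions (every
  almost-everywhere class has a Borel representative), measurable only on the domain in question.\<close>

text \<open>The power \<open>x\<^sup>a\<close> on \<open>[0,\<infinity>]\<close>, for \<open>a > 0\<close>.\<close>
definition ennpowr :: "ennreal \<Rightarrow> real \<Rightarrow> ennreal" where
  "ennpowr x a = (if x = \<infinity> then \<infinity> else ennreal (enn2real x powr a))"

definition Lnorm :: "'a measure \<Rightarrow> ennreal \<Rightarrow> ('a \<Rightarrow> ennreal) \<Rightarrow> ennreal" where
  "Lnorm M r f =
     (if r = \<infinity> then esssup M f
      else ennpowr (\<integral>\<^sup>+x. ennpowr (f x) (enn2real r) \<partial>M) (1 / enn2real r))"

text \<open>The norm of \<open>L\<^sup>q(I; L\<^sup>r(A))\<close>.\<close>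
definition mixed_norm ::
  "ennreal \<Rightarrow> ennreal \<Rightarrow> real set \<Rightarrow> 'a::euclidean_space set \<Rightarrow>
   ('a \<times> real \<Rightarrow> 'b::real_normed_vector) \<Rightarrow> ennreal" where
  "mixed_norm q r I A f =
     Lnorm (restrict_space lborel I) q
       (\<lambda>t. Lnorm (restrict_space lborel A) r (\<lambda>x. ennreal (norm (f (x, t)))))"

definition in_mixed_loc ::
  "ennreal \<Rightarrow> ennreal \<Rightarrow> real set \<Rightarrow> 'a::euclidean_space set \<Rightarrow>
   ('a \<times> real \<Rightarrow> 'b::real_normed_vector) \<Rightarrow> bool" where
  "in_mixed_loc q r I A f \<longleftrightarrow>
     f \<in> borel_measurable (restrict_space borel (A \<times> I)) \<and>
     (\<forall>J B. compact J \<and> J \<subseteq> I \<and> compact B \<and> B \<subseteq> A \<longrightarrow> mixed_norm q r J B f < \<infinity>)"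

definition in_L2 ::
  "'a::euclidean_space set \<Rightarrow> ('a \<Rightarrow> 'b::real_normed_vector) \<Rightarrow> bool" where
  "in_L2 A f \<longleftrightarrow> f \<in> borel_measurable (restrict_space borel A) \<and>
     (\<integral>\<^sup>+x\<in>A. ennreal ((norm (f x))\<^sup>2) \<partial>lborel) < \<infinity>"


section \<open>Sobolev spaces\<close>

text \<open>In \<open>g\<close>, row \<open>i\<close> and column \<open>j\<close> hold \<open>\<partial>\<^sub>j f\<^sub>i\<close>; the norm on \<open>real^'n^'n\<close> is
  the Frobenius norm.\<close>

definition weak_gradient ::
  "(real^'n) set \<Rightarrow> (real^'n \<Rightarrow> real^'n) \<Rightarrow> (real^'n \<Rightarrow> real^'n^'n) \<Rightarrow> bool" where
  "weak_gradient \<Omega> f g \<longleftrightarrow>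
     (\<forall>\<phi> i j. test_function \<Omega> \<phi> \<longrightarrow>
        (LINT x:\<Omega>|lborel. f x $ i * dir_deriv (axis j 1) \<phi> x)
          = - (LINT x:\<Omega>|lborel. g x $ i $ j * \<phi> x))"

definition in_H1 ::
  "(real^'n) set \<Rightarrow> (real^'n \<Rightarrow> real^'n) \<Rightarrow> (real^'n \<Rightarrow> real^'n^'n) \<Rightarrow> bool" where
  "in_H1 \<Omega> f g \<longleftrightarrow> in_L2 \<Omega> f \<and> in_L2 \<Omega> g \<and> weak_gradient \<Omega> f g"

text \<open>Zero trace is membership in \<open>H\<^sub>0\<^sup>1(\<Omega>)\<close>, the \<open>H\<^sup>1\<close>-closure of the test functions.\<close>
definition zero_trace ::
  "(real^'n) set \<Rightarrow> (real^'n \<Rightarrow> real^'n) \<Rightarrow> (real^'n \<Rightarrow> real^'n^'n) \<Rightarrow> bool" where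
  "zero_trace \<Omega> f g \<longleftrightarrow>
     (\<exists>\<psi> :: nat \<Rightarrow> real^'n \<Rightarrow> real^'n.
        (\<forall>k i. test_function \<Omega> (\<lambda>x. \<psi> k x $ i)) \<and>
        (\<lambda>k. \<integral>\<^sup>+x\<in>\<Omega>. ennreal ((norm (\<psi> k x - f x))\<^sup>2 +
             (norm ((\<chi> i j. dir_deriv (axis j 1) (\<lambda>y. \<psi> k y $ i) x) - g x))\<^sup>2) \<partial>lborel)
          \<longlonglongrightarrow> 0)"

text \<open>\<open>u \<in> L\<^sup>2(0,T; H\<^sup>1(\<Omega>))\<close> with spatial weak gradient \<open>G\<close>.\<close>
definition in_L2_H1 ::
  "real \<Rightarrow> (real^'n) set \<Rightarrow> ((real^'n) \<times> real \<Rightarrow> real^'n) \<Rightarrow>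
   ((real^'n) \<times> real \<Rightarrow> real^'n^'n) \<Rightarrow> bool" where
  "in_L2_H1 T \<Omega> u G \<longleftrightarrow>
     in_L2 (\<Omega> \<times> {0<..<T}) u \<and> in_L2 (\<Omega> \<times> {0<..<T}) G \<and>
     (AE t in lborel. t \<in> {0<..<T} \<longrightarrow> in_H1 \<Omega> (\<lambda>x. u (x, t)) (\<lambda>x. G (x, t)))"


section \<open>Leray--Hopf weak solutions\<close>

definition dt :: "((real^'n) \<times> real \<Rightarrow> real) \<Rightarrow> (real^'n) \<times> real \<Rightarrow> real" where
  "dt = dir_deriv (0, 1)"

definition dx :: "'n \<Rightarrow> ((real^'n) \<times> real \<Rightarrow> real) \<Rightarrow> (real^'n) \<times> real \<Rightarrow> real" where
  "dx i = dir_deriv (axis i 1, 0)"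

definition laplacian :: "((real^'n) \<times> real \<Rightarrow> real) \<Rightarrow> (real^'n) \<times> real \<Rightarrow> real" where
  "laplacian \<phi> z = (\<Sum>i\<in>UNIV. dx i (dx i \<phi>) z)"

text \<open>The equations in the sense of distributions, the convective term being written as
  \<open>div (u \<otimes> u)\<close>.\<close>
definition NS_distributional ::
  "real \<Rightarrow> ((real^'n) \<times> real) set \<Rightarrow> ((real^'n) \<times> real \<Rightarrow> real^'n) \<Rightarrow>
   ((real^'n) \<times> real \<Rightarrow> real) \<Rightarrow> bool" where
  "NS_distributional \<nu> X u p \<longleftrightarrow>
     (\<forall>\<phi>. test_function X \<phi> \<longrightarrow>
        (LINT z:X|lborel. (\<Sum>i\<in>UNIV. u z $ i * dx i \<phi> z)) = 0) \<and>
     (\<forall>\<phi> i. test_function X \<phi> \<longrightarrow>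
        (LINT z:X|lborel. u z $ i * dt \<phi> z + (\<Sum>j\<in>UNIV. u z $ i * u z $ j * dx j \<phi> z)
           + p z * dx i \<phi> z + \<nu> * (u z $ i * laplacian \<phi> z)) = 0)"

definition solenoidal :: "(real^'n) set \<Rightarrow> (real^'n \<Rightarrow> real^'n) \<Rightarrow> bool" where
  "solenoidal \<Omega> v \<longleftrightarrow> (\<forall>\<phi>. test_function \<Omega> \<phi> \<longrightarrow>
     (LINT x:\<Omega>|lborel. (\<Sum>i\<in>UNIV. v x $ i * dir_deriv (axis i 1) \<phi> x)) = 0)"

text \<open>Weak \<open>L\<^sup>2\<close> convergence to the datum as \<open>t \<rightarrow> 0\<close>, discarding a null set of times because
  \<open>u\<close> is only determined almost everywhere.\<close>
definition attains_datum ::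
  "real \<Rightarrow> (real^'n) set \<Rightarrow> ((real^'n) \<times> real \<Rightarrow> real^'n) \<Rightarrow> (real^'n \<Rightarrow> real^'n) \<Rightarrow> bool" where
  "attains_datum T \<Omega> u u0 \<longleftrightarrow>
     (\<exists>N\<in>null_sets lborel. \<forall>w. in_L2 \<Omega> w \<longrightarrow>
        ((\<lambda>t. LINT x:\<Omega>|lborel. u (x, t) \<bullet> w x) \<longlongrightarrow> (LINT x:\<Omega>|lborel. u0 x \<bullet> w x))
          (at 0 within {0<..<T} - N))"

definition energy_inequality ::
  "real \<Rightarrow> real \<Rightarrow> (real^'n) set \<Rightarrow> ((real^'n) \<times> real \<Rightarrow> real^'n) \<Rightarrow>
   ((real^'n) \<times> real \<Rightarrow> real^'n^'n) \<Rightarrow> (real^'n \<Rightarrow> real^'n) \<Rightarrow> bool" where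
  "energy_inequality \<nu> T \<Omega> u G u0 \<longleftrightarrow>
     (AE t in lborel. t \<in> {0<..<T} \<longrightarrow>
        (LINT x:\<Omega>|lborel. (norm (u (x, t)))\<^sup>2) / 2
          + \<nu> * (LINT z:\<Omega> \<times> {0<..<t}|lborel. (norm (G z))\<^sup>2)
        \<le> (LINT x:\<Omega>|lborel. (norm (u0 x))\<^sup>2) / 2)"

text \<open>\<open>G\<close> is (a version of) \<open>\<nabla>u\<close> and \<open>p\<close> is the associated pressure, taken to be a locally
  integrable function.\<close>
definition leray_hopf ::
  "real \<Rightarrow> real \<Rightarrow> (real^'n) set \<Rightarrow> ((real^'n) \<times> real \<Rightarrow> real^'n) \<Rightarrow>
   ((real^'n) \<times> real \<Rightarrow> real^'n^'n) \<Rightarrow> ((real^'n) \<times> real \<Rightarrow> real) \<Rightarrow> bool" where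
  "leray_hopf \<nu> T \<Omega> u G p \<longleftrightarrow>
     mixed_norm \<infinity> 2 {0<..<T} \<Omega> u < \<infinity> \<and>
     in_L2_H1 T \<Omega> u G \<and>
     (frontier \<Omega> \<noteq> {} \<longrightarrow>
        (AE t in lborel. t \<in> {0<..<T} \<longrightarrow> zero_trace \<Omega> (\<lambda>x. u (x, t)) (\<lambda>x. G (x, t)))) \<and>
     (\<forall>C. compact C \<and> C \<subseteq> \<Omega> \<times> {0<..<T} \<longrightarrow> set_integrable lborel C p) \<and>
     NS_distributional \<nu> (\<Omega> \<times> {0<..<T}) u p \<and>
     (\<exists>u0. in_L2 \<Omega> u0 \<and> solenoidal \<Omega> u0 \<and> attains_datum T \<Omega> u u0 \<and>
        energy_inequality \<nu> T \<Omega> u G u0)"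


section \<open>The dissipation measure\<close>

text \<open>The pairing of \<open>D[u] = - \<partial>\<^sub>t(|u|\<^sup>2/2) - div ((|u|\<^sup>2/2 + p) u) + \<nu>\<Delta>(|u|\<^sup>2/2) - \<nu>|\<nabla>u|\<^sup>2\<close>
  with a test function.  It requires \<open>|u|\<^sup>3\<close> and \<open>|p||u|\<close> to be locally integrable.\<close>
definition dissipation ::
  "real \<Rightarrow> ((real^'n) \<times> real) set \<Rightarrow> ((real^'n) \<times> real \<Rightarrow> real^'n) \<Rightarrow>
   ((real^'n) \<times> real \<Rightarrow> real^'n^'n) \<Rightarrow> ((real^'n) \<times> real \<Rightarrow> real) \<Rightarrow>
   ((real^'n) \<times> real \<Rightarrow> real) \<Rightarrow> real" where
  "dissipation \<nu> X u G p \<phi> =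
     (LINT z:X|lborel.
        (norm (u z))\<^sup>2 / 2 * dt \<phi> z
        + ((norm (u z))\<^sup>2 / 2 + p z) * (\<Sum>i\<in>UNIV. u z $ i * dx i \<phi> z)
        + \<nu> * ((norm (u z))\<^sup>2 / 2 * laplacian \<phi> z)
        - \<nu> * (norm (G z))\<^sup>2 * \<phi> z)"

definition radon_on :: "'a::topological_space set \<Rightarrow> 'a measure \<Rightarrow> bool" where
  "radon_on X M \<longleftrightarrow> sets M = sets (restrict_space borel X) \<and>
     (\<forall>C. compact C \<and> C \<subseteq> X \<longrightarrow> emeasure M C < \<infinity>)"

definition dissipation_measure ::
  "real \<Rightarrow> ((real^'n) \<times> real) set \<Rightarrow> ((real^'n) \<times> real \<Rightarrow> real^'n) \<Rightarrow>
   ((real^'n) \<times> real \<Rightarrow> real^'n^'n) \<Rightarrow> ((real^'n) \<times> real \<Rightarrow> real) \<Rightarrow>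
   ((real^'n) \<times> real) measure \<Rightarrow> bool" where
  "dissipation_measure \<nu> X u G p D \<longleftrightarrow> radon_on X D \<and>
     (\<forall>\<phi>. test_function X \<phi> \<longrightarrow> (LINT z|D. \<phi> z) = dissipation \<nu> X u G p \<phi>)"

text \<open>The measure \<open>D + \<nu>|\<nabla>u|\<^sup>2\<close>.\<close>
definition total_dissipation ::
  "real \<Rightarrow> ((real^'n) \<times> real) set \<Rightarrow> ((real^'n) \<times> real \<Rightarrow> real^'n^'n) \<Rightarrow>
   ((real^'n) \<times> real) measure \<Rightarrow> ((real^'n) \<times> real) measure" where
  "total_dissipation \<nu> X G D =
     measure_of X (sets (restrict_space borel X))
       (\<lambda>A. emeasure D A +
          emeasure (density (restrict_space lborel X) (\<lambda>z. ennreal (\<nu> * (norm (G z))\<^sup>2))) A)"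

lemma sets_total_dissipation: "sets (total_dissipation \<nu> X G D) = sets (restrict_space borel X)"
proof -
  have "space (restrict_space borel X) = X" by (simp add: space_restrict_space)
  then show ?thesis
    unfolding total_dissipation_def
    using sets.sigma_sets_eq[of "restrict_space borel X"] sets.space_closed[of "restrict_space borel X"]
    by (simp only: sets_measure_of)
qed

lemma emeasure_total_dissipation:
  assumes "radon_on X D" and A: "A \<in> sets (restrict_space borel X)"
  shows "emeasure (total_dissipation \<nu> X G D) A = emeasure D A +
    emeasure (density (restrict_space lborel X) (\<lambda>z. ennreal (\<nu> * (norm (G z))\<^sup>2))) A"
proof -
  let ?R = "restrict_space borel X"
  let ?E = "density (restrict_space lborel X) (\<lambda>z. ennreal (\<nu> * (norm (G z))\<^sup>2))"
  have D: "sets D = sets ?R" using assms by (simp add: radon_on_def)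
  have E: "sets ?E = sets ?R" by (simp add: sets_restrict_space)
  have sp: "space ?R = X" by (simp add: space_restrict_space)
  show ?thesis
  proof (rule emeasure_measure_of[OF total_dissipation_def])
    show "sets ?R \<subseteq> Pow X" using sets.space_closed[of ?R] sp by simp
    show "A \<in> sets (total_dissipation \<nu> X G D)" using A by (simp add: sets_total_dissipation)
    show "positive (sets (total_dissipation \<nu> X G D)) (\<lambda>A. emeasure D A + emeasure ?E A)"
      by (simp add: positive_def)
    show "countably_additive (sets (total_dissipation \<nu> X G D)) (\<lambda>A. emeasure D A + emeasure ?E A)"
    proof (rule countably_additiveI)
      fix F :: "nat \<Rightarrow> _" assume F: "range F \<subseteq> sets (total_dissipation \<nu> X G D)" "disjoint_family F"
      have 1: "(\<Sum>i. emeasure D (F i)) = emeasure D (\<Union>i. F i)"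
        using F D by (intro suminf_emeasure) (simp_all add: sets_total_dissipation)
      have 2: "(\<Sum>i. emeasure ?E (F i)) = emeasure ?E (\<Union>i. F i)"
        using F E by (intro suminf_emeasure) (simp_all add: sets_total_dissipation)
      show "(\<Sum>i. emeasure D (F i) + emeasure ?E (F i)) = emeasure D (\<Union>i. F i) + emeasure ?E (\<Union>i. F i)"
        unfolding 1[symmetric] 2[symmetric] by (rule suminf_add[symmetric]) simp_all
    qed
  qed
qed


section \<open>Cylinders, exponents, moduli of continuity\<close>

definition cylinder :: "real \<Rightarrow> real \<Rightarrow> 'a::metric_space \<Rightarrow> real \<Rightarrow> ('a \<times> real) set" where
  "cylinder \<alpha> \<delta> x t = ball x \<delta> \<times> {t - \<delta> powr \<alpha> <..< t + \<delta> powr \<alpha>}"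

text \<open>\<open>(r - k) / r\<close> and \<open>k / r\<close>, with their limits at \<open>r = \<infinity>\<close>.\<close>
definition gap_ratio :: "real \<Rightarrow> ennreal \<Rightarrow> real" where
  "gap_ratio k r = (if r = \<infinity> then 1 else (enn2real r - k) / enn2real r)"

definition ratio :: "real \<Rightarrow> ennreal \<Rightarrow> real" where
  "ratio k r = (if r = \<infinity> then 0 else k / enn2real r)"

definition scaling_exponent :: "nat \<Rightarrow> real \<Rightarrow> ennreal \<Rightarrow> ennreal \<Rightarrow> real" where
  "scaling_exponent d \<alpha> r q = Min
     { real d * gap_ratio 2 r - \<alpha> * ratio 2 q,
       - 1 + real d * gap_ratio 3 r + \<alpha> * gap_ratio 3 q,
       - 2 + real d * gap_ratio 2 r + \<alpha> * gap_ratio 2 q }"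

lemma scaling_exponent_r_infinity:
  assumes "q < \<infinity>"
  shows "scaling_exponent d \<alpha> \<infinity> q = Min
     { real d - \<alpha> * (2 / enn2real q),
       real d - 1 + \<alpha> * ((enn2real q - 3) / enn2real q),
       real d - 2 + \<alpha> * ((enn2real q - 2) / enn2real q) }"
  using assms by (simp add: scaling_exponent_def gap_ratio_def ratio_def)

lemma scaling_exponent_q_infinity:
  assumes "r < \<infinity>"
  shows "scaling_exponent d \<alpha> r \<infinity> = Min
     { real d * ((enn2real r - 2) / enn2real r),
       - 1 + real d * ((enn2real r - 3) / enn2real r) + \<alpha>,
       - 2 + real d * ((enn2real r - 2) / enn2real r) + \<alpha> }"
  using assms by (simp add: scaling_exponent_def gap_ratio_def ratio_def)

lemma scaling_exponent_rq_infinity: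
  "scaling_exponent d \<alpha> \<infinity> \<infinity> = min (real d) (real d - 2 + \<alpha>)"
  by (simp add: scaling_exponent_def gap_ratio_def ratio_def min_def)

definition modulus_of_continuity :: "(real \<Rightarrow> real) \<Rightarrow> bool" where
  "modulus_of_continuity \<omega> \<longleftrightarrow>
     (\<forall>\<delta>\<ge>0. 0 \<le> \<omega> \<delta>) \<and> mono_on {0..} \<omega> \<and> (\<omega> \<longlongrightarrow> 0) (at_right 0)"

end

theory Submission
  imports Defs
begin

text \<open>
  Write \<open>B\<^sub>\<delta>\<close> for the cylinder and test the local energy identity with a cutoff \<open>\<phi>\<close> that is bounded
  below by a constant on \<open>B\<^sub>\<delta>\<close>, vanishes off \<open>B\<^sub>2\<^sub>\<delta>\<close>, and scales parabolically with exponent \<open>\<alpha>\<close>: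
  \<open>\<partial>\<^sub>t\<phi> = O(\<delta> powr - \<alpha>)\<close>, \<open>\<nabla>\<phi> = O(1 / \<delta>)\<close>, \<open>\<Delta>\<phi> = O(1 / \<delta>\<^sup>2)\<close>.  Since \<open>D[u]\<close> is non-negative, the
  identity gives
  \<open>\<mu>(B\<^sub>\<delta>) \<le> const * ((\<delta> powr - \<alpha> + \<delta> powr - 2) \<integral>|u|\<^sup>2 + \<delta> powr - 1 \<integral>(|u|\<^sup>3 + |p||u|))\<close>,
  with integrals over \<open>B\<^sub>2\<^sub>\<delta>\<close> (\<open>total_dissipation_le_flux\<close>, \<open>cutoff_exists\<close>).  The three prefactors are the
  origin of the three competitors in the exponent \<open>s\<close>.

  Hoelder's inequality, in space and then in time, compares each integral with a power of the mixed
  norm of \<open>u\<close> or \<open>p\<close>, at the price of a power of the volume of \<open>B\<^sub>2\<^sub>\<delta>\<close>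
  (\<open>nn_integral_box_le_mixed_norm\<close>).  Each application pairs a single function with the constant \<open>1\<close>,
  because the product \<open>|p||u|\<close> is first split as \<open>|p||u| \<le> |p| powr (3 / 2) + |u|\<^sup>3\<close>, and the norm of \<open>p\<close> with halved
  exponents behaves like that of \<open>|u|\<^sup>2\<close>.  Counting powers of \<open>\<delta>\<close> gives
  \<open>\<mu>(B\<^sub>\<delta>) \<le> C * \<delta> powr s * E\<close> (\<open>cylinder_dissipation_le\<close>), where \<open>E\<close> collects powers of the norms
  of \<open>u\<close> and \<open>p\<close> over the time interval of \<open>B\<^sub>2\<^sub>\<delta>\<close> and a fixed compact set in space.

  Bounding \<open>E\<close> by its value on a fixed compact time interval (\<open>compact_tube\<close>) yields the estimate with a
  constant, and with it the bound on the gradient.  When \<open>q\<close> is finite, the time norm is a convergent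
  integral, so that \<open>E\<close> tends to \<open>0\<close> with the length of the interval, uniformly in its position
  (\<open>uniformly_small_powers\<close>); this is the modulus of continuity.
\<close>

section \<open>Smooth functions\<close>

lemma dir_derivI: "(f has_derivative f') (at x) \<Longrightarrow> dir_deriv b f x = f' b"
  by (simp add: dir_deriv_def frechet_derivative_at[symmetric])

lemma has_derivative_frechet:
  "f differentiable (at x) \<Longrightarrow> (f has_derivative frechet_derivative f (at x)) (at x)"
  by (simp add: frechet_derivative_works)

lemma Ck_on_SucD: "Ck_on (Suc k) S f \<Longrightarrow> Ck_on k S f"
proof (induction k arbitrary: f)
  case 0
  then show ?case
    by (auto intro!: continuous_at_imp_continuous_on differentiable_imp_continuous_within)
qed auto

lemma Ck_on_const: "Ck_on k S (\<lambda>_. c)"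
proof (induction k arbitrary: c)
  case (Suc k)
  have "dir_deriv b (\<lambda>_. c) = (\<lambda>_. 0)" for b :: 'a
    by (auto simp: dir_deriv_def)
  with Suc show ?case by simp
qed simp

lemma Ck_on_add:
  assumes "Ck_on k UNIV f" "Ck_on k UNIV g"
  shows "Ck_on k UNIV (\<lambda>x. f x + g x)"
  using assms
proof (induction k arbitrary: f g)
  case (Suc k)
  have "dir_deriv b (\<lambda>x. f x + g x) = (\<lambda>x. dir_deriv b f x + dir_deriv b g x)" for b
    using Suc.prems
    by (auto simp: dir_deriv_def intro!: ext dir_derivI[unfolded dir_deriv_def]
        has_derivative_add has_derivative_frechet)
  with Suc show ?case by auto
qed (auto intro: continuous_intros)

lemma Ck_on_mult:
  assumes "Ck_on k UNIV f" "Ck_on k UNIV g"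
  shows "Ck_on k UNIV (\<lambda>x. f x * g x)"
  using assms
proof (induction k arbitrary: f g)
  case (Suc k)
  have d: "dir_deriv b (\<lambda>x. f x * g x) = (\<lambda>x. f x * dir_deriv b g x + dir_deriv b f x * g x)" for b
    using Suc.prems
    by (auto simp: dir_deriv_def intro!: ext dir_derivI[unfolded dir_deriv_def]
        has_derivative_mult has_derivative_frechet)
  have "Ck_on k UNIV f" "Ck_on k UNIV g"
    using Suc.prems by (auto intro: Ck_on_SucD simp del: Ck_on.simps)
  with Suc show ?case unfolding Ck_on.simps d by (auto intro!: Ck_on_add)
qed (auto intro: continuous_intros)

text \<open>The chain rule reproduces the same situation one order lower, with \<open>f\<close> replaced by its
  derivative; hence the induction keeps \<open>g\<close> fixed and generalises \<open>f\<close>.\<close>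
lemma Ck_on_compose:
  fixes f :: "real \<Rightarrow> real"
  assumes "Ck_on k UNIV f" "Ck_on k UNIV g"
  shows "Ck_on k UNIV (\<lambda>x. f (g x))"
  using assms
proof (induction k arbitrary: f)
  case (Suc k)
  have d: "((\<lambda>x. f (g x)) has_derivative
      (\<lambda>h. frechet_derivative f (at (g x)) (frechet_derivative g (at x) h))) (at x)" for x
    using Suc.prems
    by (intro has_derivative_compose[where f=g and g=f] has_derivative_frechet) simp_all
  have lin: "frechet_derivative f (at y) h = dir_deriv 1 f y * h" for y h
    using Suc.prems linear_frechet_derivative[of f "at y", THEN linear_cmul, of h 1]
    by (simp add: dir_deriv_def)
  have "dir_deriv b (\<lambda>x. f (g x)) = (\<lambda>x. dir_deriv 1 f (g x) * dir_deriv b g x)" for b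
    by (rule ext, subst dir_derivI[OF d]) (simp add: lin, simp add: dir_deriv_def)
  moreover have "Ck_on k UNIV g"
    using Suc.prems by (auto intro: Ck_on_SucD simp del: Ck_on.simps)
  ultimately show ?case
    using Suc d by (auto intro!: Ck_on_mult simp: differentiable_def)
qed (auto intro: continuous_on_compose2)

lemma Ck_on_inner: "Ck_on k UNIV (\<lambda>x. x \<bullet> v)"
proof (cases k)
  case (Suc j)
  have d: "((\<lambda>x. x \<bullet> v) has_derivative (\<lambda>h. h \<bullet> v)) (at x)" for x
    by (auto intro!: derivative_eq_intros)
  have "dir_deriv b (\<lambda>x. x \<bullet> v) = (\<lambda>_. b \<bullet> v)" for b
    by (rule ext) (rule dir_derivI[OF d])
  then show ?thesis using Suc d by (auto simp: Ck_on_const differentiable_def)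
qed (auto intro: continuous_intros)

lemma Ck_on_sum:
  "finite I \<Longrightarrow> (\<And>i. i \<in> I \<Longrightarrow> Ck_on k UNIV (f i)) \<Longrightarrow> Ck_on k UNIV (\<lambda>x. \<Sum>i\<in>I. f i x)"
  by (induction I rule: finite_induct) (auto intro: Ck_on_const Ck_on_add)

text \<open>The next three lemmas serve the anisotropic dilations that turn one fixed bump into cutoffs for
  all cylinders: for a linear \<open>L\<close> that is diagonal in the standard basis, differentiation in a basis
  direction only costs the corresponding eigenvalue.\<close>
lemma has_derivative_rescale:
  fixes f :: "'a::euclidean_space \<Rightarrow> real"
  assumes L: "bounded_linear L" and f: "f differentiable (at (a + L z))"
  shows "((\<lambda>z. f (a + L z)) has_derivative
      (\<lambda>h. frechet_derivative f (at (a + L z)) (L h))) (at z)"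
proof -
  have "((\<lambda>z. a + L z) has_derivative (\<lambda>h. 0 + L h)) (at z)"
    by (intro has_derivative_add has_derivative_const bounded_linear_imp_has_derivative L)
  then have "((\<lambda>z. a + L z) has_derivative L) (at z)" by simp
  from has_derivative_compose[OF this has_derivative_frechet[OF f]] show ?thesis .
qed

lemma dir_deriv_rescale:
  fixes f :: "'a::euclidean_space \<Rightarrow> real"
  assumes L: "bounded_linear L" and Lb: "L b = c *\<^sub>R b" and f: "f differentiable (at (a + L z))"
  shows "dir_deriv b (\<lambda>z. f (a + L z)) z = c * dir_deriv b f (a + L z)"
  using linear_frechet_derivative[OF f, THEN linear_cmul, of c b]
  unfolding dir_derivI[OF has_derivative_rescale[where f=f and a=a, OF L f]] Lb
  by (simp add: dir_deriv_def)

lemma Ck_on_rescale: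
  assumes L: "bounded_linear L" and Lb: "\<And>b. b \<in> Basis \<Longrightarrow> L b = c b *\<^sub>R b"
    and "Ck_on k UNIV f"
  shows "Ck_on k UNIV (\<lambda>z. f (a + L z))"
  using assms(3)
proof (induction k arbitrary: f)
  case 0
  then show ?case
    by (auto intro!: continuous_on_compose2[of UNIV f] continuous_intros
        linear_continuous_on[OF L])
next
  case (Suc k)
  have "dir_deriv b (\<lambda>z. f (a + L z)) = (\<lambda>z. c b * dir_deriv b f (a + L z))" if "b \<in> Basis" for b
    using Suc.prems by (intro ext dir_deriv_rescale[OF L Lb[OF that]]) auto
  moreover have "(\<lambda>z. f (a + L z)) differentiable (at z)" for z
    using Suc.prems has_derivative_rescale[OF L, of f a z] by (auto simp: differentiable_def)
  moreover have "Ck_on k UNIV (\<lambda>z. c b * dir_deriv b f (a + L z))" if "b \<in> Basis" for b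
    using Suc that by (intro Ck_on_mult Ck_on_const Suc.IH) auto
  ultimately show ?case by simp
qed

lemma dir_deriv_eq_0_off:
  assumes "closed S" and "\<And>x. x \<notin> S \<Longrightarrow> f x = 0" and "x \<notin> S"
  shows "dir_deriv b f x = 0"
proof -
  have "(f has_derivative (\<lambda>_. 0)) (at x)"
    by (rule has_derivative_transform_within_open[of "\<lambda>_. 0" _ _ _ "- S"])
      (use assms in auto)
  then show ?thesis by (simp add: dir_derivI)
qed

section \<open>Cutoff functions\<close>

text \<open>The functions \<open>flat n\<close> generalise the classical smooth non-analytic function \<open>exp (- 1 / x)\<close>, which is
  \<open>flat 0\<close>.  The factor \<open>(1 / x) ^ n\<close> makes the family closed under differentiation up to linear
  combinations, so that smoothness of all members follows by one induction.\<close>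
definition flat :: "nat \<Rightarrow> real \<Rightarrow> real" where
  "flat n x = (if x \<le> 0 then 0 else (1 / x) ^ n * exp (- (1 / x)))"

lemma flat_tendsto_0: "(flat n \<longlongrightarrow> 0) (at 0)"
proof -
  have "((\<lambda>x::real. (1 / x) ^ n / exp (1 / x)) \<longlongrightarrow> 0) (at_right 0)"
    by (rule filterlim_compose[OF tendsto_power_div_exp_0])
      (simp add: divide_inverse filterlim_inverse_at_top_right)
  then have "(flat n \<longlongrightarrow> 0) (at_right 0)"
    by (rule Lim_transform_eventually)
      (auto simp: flat_def exp_minus divide_inverse intro!: eventually_at_rightI[of 0 1])
  moreover have "(flat n \<longlongrightarrow> 0) (at_left 0)"
    by (rule Lim_transform_eventually[of "\<lambda>_. 0"])
      (auto simp: flat_def intro!: eventually_at_leftI[of "-1"])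
  ultimately show ?thesis by (simp add: filterlim_split_at)
qed

lemma flat_has_derivative:
  "(flat n has_real_derivative (flat (n + 2) x - real n * flat (n + 1) x)) (at x)"
proof -
  consider "x < 0" | "x = 0" | "x > 0" by linarith
  then show ?thesis
  proof cases
    case 1
    have "(flat n has_real_derivative 0) (at x)"
      by (rule has_field_derivative_transform_within_open[of "\<lambda>_. 0" _ _ "{..<0}"])
        (use 1 in \<open>auto simp: flat_def\<close>)
    then show ?thesis using 1 by (simp add: flat_def)
  next
    case 2
    \<comment> \<open>At the origin the difference quotient of \<open>flat n\<close> is \<open>flat (n + 1)\<close> itself.\<close>
    have "((\<lambda>h. (flat n h - flat n 0) / (h - 0)) \<longlongrightarrow> 0) (at 0)"
      by (rule Lim_transform_eventually[OF flat_tendsto_0[of "n+1"]])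
        (auto simp: flat_def eventually_at_filter)
    then show ?thesis using 2 by (simp add: has_field_derivative_iff flat_def)
  next
    case 3
    have "((\<lambda>x. (1 / x) ^ n * exp (- (1 / x))) has_real_derivative
        (real n * (1 / x) ^ (n - 1) * (- ((1 / x)\<^sup>2)) * exp (- (1 / x))
          + (1 / x) ^ n * (exp (- (1 / x)) * (1 / x)\<^sup>2))) (at x)"
      using 3 by (auto intro!: derivative_eq_intros simp: power2_eq_square)
    moreover have "real n * y ^ (n - 1) * (- (y\<^sup>2)) * E + y ^ n * (E * y\<^sup>2) =
        y ^ (n + 2) * E - real n * (y ^ (n + 1) * E)" for y E :: real
      by (cases n) (simp_all add: algebra_simps power2_eq_square)
    ultimately have "((\<lambda>x. (1 / x) ^ n * exp (- (1 / x))) has_real_derivative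
        (flat (n + 2) x - real n * flat (n + 1) x)) (at x)"
      using 3 by (simp add: flat_def)
    then show ?thesis
      by (rule has_field_derivative_transform_within_open[of _ _ _ "{0<..}"])
        (use 3 in \<open>auto simp: flat_def\<close>)
  qed
qed

lemma Ck_on_flat: "Ck_on k UNIV (flat n)"
proof (induction k arbitrary: n)
  case 0
  show ?case
    using DERIV_isCont[OF flat_has_derivative] by (simp add: continuous_at_imp_continuous_on)
next
  case (Suc k)
  have d: "(flat n has_derivative (\<lambda>h. (flat (n + 2) x + (- real n) * flat (n + 1) x) * h)) (at x)" for x
    using flat_has_derivative by (simp add: has_field_derivative_def)
  have "dir_deriv 1 (flat n) = (\<lambda>x. flat (n + 2) x + (- real n) * flat (n + 1) x)"
    by (rule ext, subst dir_derivI[OF d]) simp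
  moreover have "Ck_on k UNIV (\<lambda>x. flat (n + 2) x + (- real n) * flat (n + 1) x)"
    by (intro Ck_on_add Ck_on_mult Ck_on_const Suc)
  ultimately show ?case
    using d by (auto simp: differentiable_def)
qed

lemma flat0_pos: "0 < x \<Longrightarrow> 0 < flat 0 x" by (simp add: flat_def)
lemma flat0_nonneg: "0 \<le> flat 0 x" by (simp add: flat_def)
lemma flat0_mono: "x \<le> y \<Longrightarrow> flat 0 x \<le> flat 0 y" by (auto simp: flat_def frac_le)
lemma flat0_le_1: "flat 0 x \<le> 1" by (simp add: flat_def)

text \<open>A plateau, which would require dividing by a smooth function, is avoided: for the estimate it is
  enough that the bump is bounded below on the unit cylinder.\<close>
definition bump :: "real \<Rightarrow> 'a::euclidean_space \<times> real \<Rightarrow> real" where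
  "bump R z = flat 0 (4 - (norm (fst z))\<^sup>2) * flat 0 (R\<^sup>2 - (snd z)\<^sup>2)"

lemma smooth_bump: "smooth_on UNIV (bump R)"
  unfolding smooth_on_def
proof
  fix k
  \<comment> \<open>Both arguments of \<open>flat 0\<close> are polynomials in the coordinates \<open>z \<bullet> b\<close>.\<close>
  have 1: "(norm (fst z))\<^sup>2 = (\<Sum>b\<in>Basis. (z \<bullet> (b, 0)) * (z \<bullet> (b, 0)))" for z :: "'a \<times> real"
    by (subst norm_eq_sqrt_inner, subst real_sqrt_pow2, simp, subst euclidean_inner)
      (simp add: inner_prod_def)
  have 2: "(snd z)\<^sup>2 = (z \<bullet> (0, 1)) * (z \<bullet> (0, 1))" for z :: "'a \<times> real"
    by (simp add: inner_prod_def power2_eq_square)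
  have "Ck_on k UNIV (\<lambda>z::'a \<times> real. flat 0 (4 + (-1) * (norm (fst z))\<^sup>2) * flat 0 (R\<^sup>2 + (-1) * (snd z)\<^sup>2))"
    unfolding 1 2
    by (intro Ck_on_mult Ck_on_compose[OF Ck_on_flat] Ck_on_add Ck_on_const Ck_on_sum Ck_on_inner) simp
  then show "Ck_on k UNIV (bump R :: 'a \<times> real \<Rightarrow> real)" by (simp add: bump_def[abs_def])
qed

lemma bump_eq_0: "z \<notin> cball 0 2 \<times> {-R..R} \<Longrightarrow> R \<ge> 0 \<Longrightarrow> bump R z = 0"
proof -
  assume z: "z \<notin> cball 0 2 \<times> {-R..R}" and R: "R \<ge> 0"
  then have "2 < norm (fst z) \<or> R < \<bar>snd z\<bar>" by (cases z) (auto simp: abs_if)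
  then show ?thesis
  proof
    assume "2 < norm (fst z)"
    then have "2\<^sup>2 \<le> (norm (fst z))\<^sup>2" by (intro power_mono) simp_all
    then show ?thesis by (simp add: bump_def flat_def)
  next
    assume "R < \<bar>snd z\<bar>"
    then have "R\<^sup>2 \<le> \<bar>snd z\<bar>\<^sup>2" using R by (intro power_mono) simp_all
    then show ?thesis by (simp add: bump_def flat_def)
  qed
qed

lemma smooth_continuous: "smooth_on UNIV f \<Longrightarrow> continuous_on UNIV f"
  unfolding smooth_on_def by (metis Ck_on.simps(1))

lemma smooth_dir_deriv: "smooth_on UNIV f \<Longrightarrow> b \<in> Basis \<Longrightarrow> smooth_on UNIV (dir_deriv b f)"
  unfolding smooth_on_def by (metis Ck_on.simps(2))

lemma smooth_differentiable: "smooth_on UNIV f \<Longrightarrow> f differentiable (at x)"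
  unfolding smooth_on_def by (metis Ck_on.simps(2) UNIV_I)

lemma compactly_supported_bounded:
  fixes f :: "'a::euclidean_space \<Rightarrow> real"
  assumes f: "continuous_on UNIV f" and S: "compact S" and 0: "\<And>x. x \<notin> S \<Longrightarrow> f x = 0"
  shows "\<exists>M. \<forall>x. \<bar>f x\<bar> \<le> M"
proof -
  have "bounded (f ` S)"
    using f S by (intro compact_imp_bounded compact_continuous_image continuous_on_subset[OF f]) auto
  then obtain M where M: "\<And>x. x \<in> S \<Longrightarrow> \<bar>f x\<bar> \<le> M"
    unfolding bounded_iff by auto
  have "\<bar>f x\<bar> \<le> max M 0" for x
    using M[of x] 0[of x] by (cases "x \<in> S") auto
  then show ?thesis by blast
qed

lemma dt_basis: "(0, 1) \<in> (Basis :: ((real^'n) \<times> real) set)"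
  by (auto simp: Basis_prod_def)

lemma dx_basis: "(axis i 1, 0) \<in> (Basis :: ((real^'n) \<times> real) set)"
  by (auto simp: Basis_prod_def Basis_vec_def)

lemma smooth_dt: "smooth_on UNIV f \<Longrightarrow> smooth_on UNIV (dt f)"
  unfolding dt_def by (intro smooth_dir_deriv dt_basis)

lemma smooth_dx: "smooth_on UNIV f \<Longrightarrow> smooth_on UNIV (dx i f)"
  unfolding dx_def by (intro smooth_dir_deriv dx_basis)

lemma derivs_eq_0_off:
  assumes "closed S" "\<And>z. z \<notin> S \<Longrightarrow> f z = 0" "z \<notin> S"
  shows "dt f z = 0" "dx i f z = 0" "laplacian f z = 0"
proof -
  have 1: "dx i g z = 0" if "\<And>z. z \<notin> S \<Longrightarrow> g z = 0" "z \<notin> S" for g i z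
    unfolding dx_def using assms(1) that by (rule dir_deriv_eq_0_off)
  show "dt f z = 0" unfolding dt_def using assms by (rule dir_deriv_eq_0_off)
  show "dx i f z = 0" using assms(2,3) by (rule 1)
  have "dx i (dx i f) z = 0" for i
    using assms(2,3) by (intro 1)
  then show "laplacian f z = 0" by (simp add: laplacian_def)
qed

lemma derivs_bounded:
  fixes f :: "(real^'n) \<times> real \<Rightarrow> real"
  assumes f: "smooth_on UNIV f" and S: "compact S" "\<And>z. z \<notin> S \<Longrightarrow> f z = 0"
  shows "\<exists>M\<ge>0. \<forall>z. \<bar>dt f z\<bar> \<le> M \<and> (\<forall>i. \<bar>dx i f z\<bar> \<le> M) \<and> \<bar>laplacian f z\<bar> \<le> M"
proof -
  have off: "dt f z = 0" "dx i f z = 0" "laplacian f z = 0" if "z \<notin> S" for i z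
    using derivs_eq_0_off[OF compact_imp_closed[OF S(1)], of f] S(2) that by auto
  have lap: "continuous_on UNIV (laplacian f)"
    unfolding laplacian_def by (intro continuous_on_sum smooth_continuous smooth_dx f)
  obtain M1 where M1: "\<bar>dt f z\<bar> \<le> M1" for z
    using compactly_supported_bounded[OF smooth_continuous[OF smooth_dt[OF f]] S(1)] off by blast
  have "\<exists>M. \<forall>z. \<bar>dx i f z\<bar> \<le> M" for i
    using compactly_supported_bounded[OF smooth_continuous[OF smooth_dx[OF f]] S(1)] off by blast
  then obtain M2 where M2: "\<And>i z. \<bar>dx i f z\<bar> \<le> M2 i" by metis
  obtain M3 where M3: "\<bar>laplacian f z\<bar> \<le> M3" for z
    using compactly_supported_bounded[OF lap S(1)] off by blast
  let ?M = "\<bar>M1\<bar> + (\<Sum>i\<in>UNIV. \<bar>M2 i\<bar>) + \<bar>M3\<bar>"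
  have sum: "\<bar>M2 i\<bar> \<le> (\<Sum>i\<in>UNIV. \<bar>M2 i\<bar>)" for i
    by (rule member_le_sum[of i UNIV "\<lambda>i. \<bar>M2 i\<bar>"]) auto
  have "0 \<le> (\<Sum>i\<in>UNIV. \<bar>M2 i\<bar>)" by (simp add: sum_nonneg)
  then have "\<bar>dt f z\<bar> \<le> ?M" and "\<bar>laplacian f z\<bar> \<le> ?M" for z
    using M1[of z] M3[of z] by linarith+
  moreover have "\<bar>dx i f z\<bar> \<le> ?M" for i z
    using M2[of i z] sum[of i] by linarith
  moreover have "0 \<le> ?M" by (simp add: sum_nonneg)
  ultimately show ?thesis by blast
qed

text \<open>With \<open>l = 1 / \<delta>\<close> and \<open>m = 1 / \<delta> powr \<alpha>\<close> this is where the three prefactors of the energy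
  estimate come from.\<close>
lemma derivs_rescale:
  fixes f :: "(real^'n) \<times> real \<Rightarrow> real" and a0 :: "(real^'n) \<times> real" and l m :: real
  assumes f: "smooth_on UNIV f"
  defines "L \<equiv> \<lambda>z. (l *\<^sub>R fst z, m * snd z)"
  defines "g \<equiv> \<lambda>z. f (a0 + L z)"
  shows "smooth_on UNIV g"
    and "dt g z = m * dt f (a0 + L z)"
    and "dx i g z = l * dx i f (a0 + L z)"
    and "laplacian g z = l\<^sup>2 * laplacian f (a0 + L z)"
proof -
  have L: "bounded_linear L"
    unfolding L_def by (intro bounded_linear_intros)
  have Lt: "L (0, 1) = m *\<^sub>R (0, 1)" and Lx: "L (axis i 1, 0) = l *\<^sub>R (axis i 1, 0)" for i
    by (auto simp: L_def)
  have Lb: "L b = (if snd b = 0 then l else m) *\<^sub>R b" if "b \<in> Basis" for b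
    using that by (auto simp: L_def Basis_prod_def)
  show "smooth_on UNIV g"
    using f Ck_on_rescale[OF L Lb] by (auto simp: smooth_on_def g_def)
  show "dt g z = m * dt f (a0 + L z)"
    unfolding dt_def g_def by (rule dir_deriv_rescale[OF L Lt smooth_differentiable[OF f]])
  have resc: "dx i (\<lambda>z. h (a0 + L z)) z = l * dx i h (a0 + L z)" if "smooth_on UNIV h" for h i z
    unfolding dx_def by (rule dir_deriv_rescale[OF L Lx smooth_differentiable[OF that]])
  then show "dx i g z = l * dx i f (a0 + L z)" using f by (simp add: g_def)
  have cmult: "dx i (\<lambda>z. l * h z) z = l * dx i h z" if "smooth_on UNIV h" for h i z
  proof -
    have "((\<lambda>z. l * h z) has_derivative (\<lambda>v. l * frechet_derivative h (at z) v)) (at z)"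
      by (intro has_derivative_mult_right has_derivative_frechet smooth_differentiable that)
    from dir_derivI[OF this] show ?thesis by (simp add: dx_def dir_deriv_def)
  qed
  have "dx i g = (\<lambda>z. l * dx i f (a0 + L z))" for i
    using resc[OF f] by (auto simp: g_def)
  moreover have "smooth_on UNIV (\<lambda>z. dx i f (a0 + L z))" for i
    using smooth_dx[OF f] Ck_on_rescale[OF L Lb] by (auto simp: smooth_on_def)
  ultimately have "dx i (dx i g) z = l * (l * dx i (dx i f) (a0 + L z))" for i
    using cmult[of "\<lambda>z. dx i f (a0 + L z)" i z] resc[OF smooth_dx[OF f], of i i z] by simp
  then show "laplacian g z = l\<^sup>2 * laplacian f (a0 + L z)"
    by (simp add: laplacian_def sum_distrib_left power2_eq_square mult.assoc)
qed

text \<open>All cutoffs are translates and dilates of a single bump, which is why \<open>c\<close> and \<open>M\<close> do not depend on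
  the cylinder.\<close>
lemma cutoff_exists:
  fixes \<alpha> :: real
  assumes "0 < \<alpha>"
  shows "\<exists>c M. 0 < c \<and> 0 \<le> M \<and> (\<forall>(x::real^'n) t \<delta>. 0 < \<delta> \<longrightarrow> (\<exists>\<phi>.
    smooth_on UNIV \<phi> \<and> (\<forall>z. 0 \<le> \<phi> z \<and> \<phi> z \<le> 1) \<and> (\<forall>z\<in>cylinder \<alpha> \<delta> x t. c \<le> \<phi> z) \<and>
    (\<forall>z. z \<notin> cball x (2 * \<delta>) \<times> {t - (2 * \<delta>) powr \<alpha> .. t + (2 * \<delta>) powr \<alpha>} \<longrightarrow> \<phi> z = 0) \<and>
    (\<forall>z. \<bar>dt \<phi> z\<bar> \<le> M / \<delta> powr \<alpha> \<and> (\<forall>i. \<bar>dx i \<phi> z\<bar> \<le> M / \<delta>) \<and> \<bar>laplacian \<phi> z\<bar> \<le> M / \<delta>\<^sup>2)))"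
proof -
  \<comment> \<open>The bump lives on the cylinder of radius \<open>2\<close> and half-length \<open>2 powr \<alpha>\<close>, so that its dilate lives
    on the cylinder of parameter \<open>2 * \<delta>\<close>; a half-length of \<open>2\<close> would be too long for small \<open>\<alpha>\<close>.\<close>
  define R where "R = (2::real) powr \<alpha>"
  have R: "1 < R" using assms by (simp add: R_def)
  let ?\<Phi> = "bump R :: (real^'n) \<times> real \<Rightarrow> real"
  have "compact (cball (0::real^'n) 2 \<times> {-R..R})" by (intro compact_Times) auto
  moreover have "\<And>z. z \<notin> cball (0::real^'n) 2 \<times> {-R..R} \<Longrightarrow> ?\<Phi> z = 0"
    using R by (intro bump_eq_0) auto
  ultimately have "\<exists>M\<ge>0. \<forall>z. \<bar>dt ?\<Phi> z\<bar> \<le> M \<and> (\<forall>i. \<bar>dx i ?\<Phi> z\<bar> \<le> M) \<and> \<bar>laplacian ?\<Phi> z\<bar> \<le> M"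
    by (rule derivs_bounded[OF smooth_bump])
  then obtain M where M: "0 \<le> M"
    "\<And>z. \<bar>dt ?\<Phi> z\<bar> \<le> M" "\<And>z i. \<bar>dx i ?\<Phi> z\<bar> \<le> M" "\<And>z. \<bar>laplacian ?\<Phi> z\<bar> \<le> M"
    by blast
  define c where "c = flat 0 3 * flat 0 (R\<^sup>2 - 1)"
  have R2: "1 < R\<^sup>2" using R by (simp add: one_less_power)
  then have "0 < c" unfolding c_def by (intro mult_pos_pos flat0_pos) auto
  moreover have "\<exists>\<phi>. smooth_on UNIV \<phi> \<and> (\<forall>z. 0 \<le> \<phi> z \<and> \<phi> z \<le> 1) \<and> (\<forall>z\<in>cylinder \<alpha> \<delta> x t. c \<le> \<phi> z) \<and>
    (\<forall>z. z \<notin> cball x (2 * \<delta>) \<times> {t - (2 * \<delta>) powr \<alpha> .. t + (2 * \<delta>) powr \<alpha>} \<longrightarrow> \<phi> z = 0) \<and>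
    (\<forall>z. \<bar>dt \<phi> z\<bar> \<le> M / \<delta> powr \<alpha> \<and> (\<forall>i. \<bar>dx i \<phi> z\<bar> \<le> M / \<delta>) \<and> \<bar>laplacian \<phi> z\<bar> \<le> M / \<delta>\<^sup>2)"
    if \<delta>: "0 < \<delta>" for x :: "real^'n" and t \<delta> :: real
  proof -
    define e where "e = \<delta> powr \<alpha>"
    have e: "0 < e" using \<delta> by (simp add: e_def)
    have e2: "(2 * \<delta>) powr \<alpha> = R * e" using \<delta> by (simp add: powr_mult R_def e_def)
    define A where "A z = (- (1 / \<delta>) *\<^sub>R x, - (1 / e) * t) + ((1 / \<delta>) *\<^sub>R fst z, (1 / e) * snd z)"
      for z :: "(real^'n) \<times> real"
    have A: "A z = ((1 / \<delta>) *\<^sub>R (fst z - x), (snd z - t) / e)" for z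
      by (simp add: A_def algebra_simps diff_divide_distrib)
    define \<phi> where "\<phi> z = ?\<Phi> (A z)" for z
    note resc = derivs_rescale[where f = ?\<Phi> and l = "1 / \<delta>" and m = "1 / e"
        and ?a0.0 = "(- (1 / \<delta>) *\<^sub>R x, - (1 / e) * t)", OF smooth_bump, folded A_def, folded \<phi>_def]
    have normA: "norm (fst (A z)) = dist x (fst z) / \<delta>" for z
      using \<delta> by (simp add: A dist_norm norm_minus_commute)
    have "0 \<le> \<phi> z \<and> \<phi> z \<le> 1" for z
      by (auto simp: \<phi>_def bump_def flat0_nonneg intro!: mult_le_one flat0_le_1)
    moreover have "c \<le> \<phi> z" if "z \<in> cylinder \<alpha> \<delta> x t" for z
    proof -
      have "dist x (fst z) / \<delta> \<le> 1" and "\<bar>snd z - t\<bar> / e \<le> 1"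
        using that \<delta> e by (auto simp: cylinder_def e_def[symmetric])
      then have "norm (fst (A z)) \<le> 1" and "\<bar>snd (A z)\<bar> \<le> 1"
        unfolding normA using e by (simp_all add: A abs_divide)
      then have "(norm (fst (A z)))\<^sup>2 \<le> 1" and "(snd (A z))\<^sup>2 \<le> 1"
        by (auto simp: abs_square_le_1 power_le_one)
      then show ?thesis unfolding \<phi>_def bump_def c_def
        by (intro mult_mono flat0_mono flat0_nonneg) auto
    qed
    moreover have "\<phi> z = 0"
      if "z \<notin> cball x (2 * \<delta>) \<times> {t - (2 * \<delta>) powr \<alpha> .. t + (2 * \<delta>) powr \<alpha>}" for z
    proof -
      have "\<not> (dist x (fst z) \<le> 2 * \<delta> \<and> \<bar>snd z - t\<bar> \<le> R * e)"
        using that unfolding e2 by (cases z) (auto simp: abs_if split: if_splits)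
      moreover have "dist x (fst z) \<le> 2 * \<delta> \<and> \<bar>snd z - t\<bar> \<le> R * e" if "A z \<in> cball 0 2 \<times> {-R..R}"
      proof -
        have "norm (fst (A z)) \<le> 2" and "\<bar>snd (A z)\<bar> \<le> R"
          using that by (auto simp: mem_Times_iff abs_le_iff)
        then have "dist x (fst z) / \<delta> \<le> 2" and "\<bar>snd z - t\<bar> / e \<le> R"
          unfolding normA using e by (simp_all add: A abs_divide)
        then show ?thesis using \<delta> e by (simp add: field_simps)
      qed
      ultimately show ?thesis using R unfolding \<phi>_def by (intro bump_eq_0) auto
    qed
    moreover have "\<bar>dt \<phi> z\<bar> \<le> M / \<delta> powr \<alpha> \<and> (\<forall>i. \<bar>dx i \<phi> z\<bar> \<le> M / \<delta>) \<and> \<bar>laplacian \<phi> z\<bar> \<le> M / \<delta>\<^sup>2" for z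
      using M \<delta> e unfolding resc e_def[symmetric]
      by (auto simp: abs_mult divide_right_mono power_divide)
    ultimately show ?thesis using resc(1) by blast
  qed
  ultimately show ?thesis using M(1) by blast
qed

section \<open>Lebesgue norms and mixed norms\<close>

lemma ennpowr_ennreal: "0 \<le> x \<Longrightarrow> ennpowr (ennreal x) a = ennreal (x powr a)"
  by (simp add: ennpowr_def)

lemma ennpowr_top [simp]: "ennpowr top a = top"
  by (simp add: ennpowr_def)

lemma ennpowr_0 [simp]: "ennpowr 0 a = 0"
  by (simp add: ennpowr_def)

lemma ennpowr_mono: "x \<le> y \<Longrightarrow> 0 \<le> a \<Longrightarrow> ennpowr x a \<le> ennpowr y a"
  by (cases x; cases y) (auto simp: ennpowr_ennreal top_unique intro!: ennreal_leI powr_mono2)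

lemma ennpowr_ennpowr: "ennpowr (ennpowr x a) b = ennpowr x (a * b)"
  by (cases x) (auto simp: ennpowr_ennreal powr_powr)

lemma ennpowr_less_top: "x < top \<Longrightarrow> ennpowr x a < top"
  by (cases x) (auto simp: ennpowr_ennreal)

lemma ennpowr_eq_0_iff: "ennpowr x a = 0 \<longleftrightarrow> x = 0"
  by (cases x) (auto simp: ennpowr_ennreal)

lemma measurable_ennpowr [measurable (raw)]:
  assumes [measurable]: "f \<in> borel_measurable M"
  shows "(\<lambda>x. ennpowr (f x) a) \<in> borel_measurable M"
  unfolding ennpowr_def by measurable

text \<open>Hoelder's inequality against the constant \<open>1\<close>.  For finite \<open>r\<close> it is the concavity of
  \<open>y \<mapsto> y powr (k / r)\<close>: integrate the tangent line inequality at the mean value of \<open>f powr r\<close>.\<close>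
lemma nn_integral_powr_le_Lnorm:
  assumes f [measurable]: "f \<in> borel_measurable M"
    and m: "emeasure M (space M) = ennreal m" "0 < m"
    and k: "0 < k" "ennreal k \<le> r"
  shows "(\<integral>\<^sup>+x. ennpowr (f x) k \<partial>M) \<le> ennpowr (Lnorm M r f) k * ennreal (m powr gap_ratio k r)"
proof (cases "r = \<infinity>")
  case True
  have "AE x in M. ennpowr (f x) k \<le> ennpowr (esssup M f) k"
    using esssup_AE[of f M] by eventually_elim (use k in \<open>auto intro: ennpowr_mono\<close>)
  then have "(\<integral>\<^sup>+x. ennpowr (f x) k \<partial>M) \<le> (\<integral>\<^sup>+x. ennpowr (esssup M f) k \<partial>M)"
    by (rule nn_integral_mono_AE)
  also have "\<dots> = ennpowr (esssup M f) k * ennreal m" using m by simp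
  finally show ?thesis using True m by (simp add: Lnorm_def gap_ratio_def)
next
  case False
  define R where "R = enn2real r"
  have R: "r = ennreal R" using False by (cases r) (auto simp: R_def)
  have kR: "k \<le> R" and R0: "0 < R"
    using k False unfolding R by (auto simp: ennreal_le_iff2)
  define \<theta> where "\<theta> = k / R"
  have \<theta>: "0 < \<theta>" "\<theta> \<le> 1" using kR R0 k by (auto simp: \<theta>_def)
  define A where "A = (\<integral>\<^sup>+x. ennpowr (f x) R \<partial>M)"
  have rhs: "ennpowr (Lnorm M r f) k * ennreal (m powr gap_ratio k r) =
      ennpowr A \<theta> * ennreal (m powr (1 - \<theta>))"
    using False R0 by (simp add: Lnorm_def gap_ratio_def ennpowr_ennpowr \<theta>_def A_def
        R_def[symmetric] diff_divide_distrib)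
  consider "A = \<infinity>" | "A = 0" | a where "A = ennreal a" "0 < a"
    by (cases A) (auto simp: order_le_less)
  then show ?thesis
  proof cases
    case 1
    then show ?thesis unfolding rhs using m by (simp add: ennreal_top_mult)
  next
    case 2
    then have "AE x in M. ennpowr (f x) R = 0"
      unfolding A_def by (subst (asm) nn_integral_0_iff_AE) simp_all
    then have "AE x in M. ennpowr (f x) k = 0"
      by eventually_elim (simp add: ennpowr_eq_0_iff)
    then have "(\<integral>\<^sup>+x. ennpowr (f x) k \<partial>M) = 0"
      by (subst nn_integral_0_iff_AE) simp_all
    then show ?thesis by simp
  next
    case 3
    \<comment> \<open>\<open>b\<close> is the mean of \<open>f powr R\<close>, and \<open>C1 * x + C2\<close> is the tangent to \<open>x powr \<theta>\<close> at \<open>x = b\<close>.\<close>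
    define b where "b = a / m"
    have b: "0 < b" using 3 m by (simp add: b_def)
    define C1 where "C1 = \<theta> * b powr (\<theta> - 1)"
    define C2 where "C2 = (1 - \<theta>) * b powr \<theta>"
    have C: "0 < C1" "0 \<le> C2" using \<theta> b by (auto simp: C1_def C2_def)
    have young: "y powr k \<le> C1 * y powr R + C2" if "0 < y" for y
    proof -
      have "(y powr R) powr \<theta> * b powr (1 - \<theta>) \<le> \<theta> * y powr R + (1 - \<theta>) * b"
        using \<theta> b that by (intro Youngs_inequality_0) auto
      then have "(y powr R) powr \<theta> * b powr (1 - \<theta>) * b powr (\<theta> - 1)
          \<le> (\<theta> * y powr R + (1 - \<theta>) * b) * b powr (\<theta> - 1)"
        by (intro mult_right_mono) auto
      also have "(y powr R) powr \<theta> * b powr (1 - \<theta>) * b powr (\<theta> - 1) = y powr k"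
        using b R0 by (simp add: powr_powr \<theta>_def mult.assoc powr_add[symmetric])
      also have "(\<theta> * y powr R + (1 - \<theta>) * b) * b powr (\<theta> - 1) = C1 * y powr R + C2"
        using b powr_add[of b 1 "\<theta> - 1"] by (simp add: C1_def C2_def algebra_simps)
      finally show ?thesis .
    qed
    have "ennpowr y k \<le> ennreal C1 * ennpowr y R + ennreal C2" for y
    proof (cases y)
      case (real y')
      show ?thesis
      proof (cases "y' = 0")
        case False
        then show ?thesis using real young[of y'] C
          by (simp add: ennpowr_ennreal ennreal_mult'[symmetric] ennreal_plus[symmetric]
              del: ennreal_plus)
      qed (use real in simp)
    qed (use C in \<open>simp add: ennreal_mult_top\<close>)
    then have "(\<integral>\<^sup>+x. ennpowr (f x) k \<partial>M) \<le> (\<integral>\<^sup>+x. ennreal C1 * ennpowr (f x) R + ennreal C2 \<partial>M)"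
      by (intro nn_integral_mono)
    also have "\<dots> = ennreal C1 * A + ennreal C2 * ennreal m"
      using m by (simp add: nn_integral_add nn_integral_cmult A_def)
    also have "\<dots> = ennreal (C1 * a + C2 * m)"
      using 3 C m by (simp add: ennreal_mult'[symmetric] ennreal_plus[symmetric] del: ennreal_plus)
    also have "C1 * a + C2 * m = a powr \<theta> * m powr (1 - \<theta>)"
    proof -
      have "b powr (\<theta> - 1) * a = a powr \<theta> * m powr (1 - \<theta>)"
        using 3 m powr_add[of a "\<theta> - 1" 1] powr_minus_divide[of m "\<theta> - 1"]
        by (simp add: b_def powr_divide algebra_simps)
      moreover have "b powr \<theta> * m = a powr \<theta> * m powr (1 - \<theta>)"
        using 3 m powr_diff[of m 1 \<theta>] by (simp add: b_def powr_divide)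
      ultimately show ?thesis
        unfolding C1_def C2_def by (simp add: mult.assoc) (simp add: algebra_simps)
    qed
    finally show ?thesis unfolding rhs
      using 3 by (simp add: ennpowr_ennreal ennreal_mult')
  qed
qed

text \<open>For \<open>r = \<infinity>\<close> the essential supremum exceeds \<open>y\<close> exactly at those times whose superlevel set has positive
  measure, and this measure depends measurably on time by Fubini's theorem.\<close>
lemma borel_measurable_Lnorm:
  fixes f :: "'a::euclidean_space \<times> real \<Rightarrow> ennreal"
  assumes f [measurable]: "f \<in> borel_measurable borel" and B [measurable]: "B \<in> sets borel"
  shows "(\<lambda>t. Lnorm (restrict_space lborel B) r (\<lambda>x. f (x, t))) \<in> borel_measurable borel"
proof -
  have f' [measurable]: "f \<in> borel_measurable (borel \<Otimes>\<^sub>M borel)"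
    by (simp add: borel_prod)
  show ?thesis
  proof (cases "r = \<infinity>")
    case True
    have "{t \<in> space borel. y < esssup (restrict_space lborel B) (\<lambda>x. f (x, t))} \<in> sets borel" for y
    proof -
      let ?e = "\<lambda>t. emeasure lborel {x \<in> space lborel. x \<in> B \<and> y < f (x, t)}"
      have m: "(\<lambda>x. f (x, t)) \<in> borel_measurable (restrict_space lborel B)" for t
        by (rule measurable_restrict_space1) measurable
      have eq: "emeasure (restrict_space lborel B) {x \<in> space (restrict_space lborel B). y < f (x, t)}
          = ?e t" for t
        by (subst emeasure_restrict_space) (auto simp: space_restrict_space intro!: arg_cong[where f="emeasure lborel"])
      have "y < esssup (restrict_space lborel B) (\<lambda>x. f (x, t)) \<longleftrightarrow> 0 < ?e t" for t
      proof
        assume "0 < ?e t"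
        show "y < esssup (restrict_space lborel B) (\<lambda>x. f (x, t))"
        proof (rule ccontr)
          assume "\<not> ?thesis"
          then have "esssup (restrict_space lborel B) (\<lambda>x. f (x, t)) \<le> y" by simp
          have "AE x in restrict_space lborel B. f (x, t) \<le> y"
            using esssup_AE[of "\<lambda>x. f (x, t)" "restrict_space lborel B"]
              \<open>esssup (restrict_space lborel B) (\<lambda>x. f (x, t)) \<le> y\<close>
            by (auto elim!: eventually_mono)
          then have "AE x in lborel. x \<in> B \<longrightarrow> f (x, t) \<le> y"
            by (subst (asm) AE_restrict_space_iff) auto
          then have "?e t = 0"
            by (subst (asm) AE_iff_measurable[OF _ refl]) (auto simp: not_le)
          with \<open>0 < ?e t\<close> show False by simp
        qed
      next
        assume "y < esssup (restrict_space lborel B) (\<lambda>x. f (x, t))"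
        from esssup_pos_measure[OF m this] show "0 < ?e t" unfolding eq .
      qed
      moreover have "{t \<in> space borel. 0 < ?e t} \<in> sets borel"
        by measurable
      ultimately show ?thesis by simp
    qed
    then show ?thesis using True by (simp add: Lnorm_def borel_measurableI_greater)
  next
    case False
    have "(\<lambda>t. \<integral>\<^sup>+x. ennpowr (f (x, t)) (enn2real r) * indicator B x \<partial>lborel) \<in> borel_measurable borel"
      by measurable
    then show ?thesis using False
      by (simp add: Lnorm_def nn_integral_restrict_space)
  qed
qed

lemma Lnorm_restrict_mono:
  assumes f: "f \<in> borel_measurable lborel" and "A \<in> sets lborel" "B \<in> sets lborel" "A \<subseteq> B"
  shows "Lnorm (restrict_space lborel A) r f \<le> Lnorm (restrict_space lborel B) r f"
proof (cases "r = \<infinity>")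
  case True
  have "AE x in restrict_space lborel B. f x \<le> esssup (restrict_space lborel B) f"
    by (rule esssup_AE)
  then have "AE x in restrict_space lborel A. f x \<le> esssup (restrict_space lborel B) f"
    using assms by (simp add: AE_restrict_space_iff) (auto elim!: eventually_mono)
  then have "esssup (restrict_space lborel A) f \<le> esssup (restrict_space lborel B) f"
    using f by (intro esssup_I measurable_restrict_space1)
  then show ?thesis using True by (simp add: Lnorm_def)
next
  case False
  then show ?thesis using assms
    by (auto simp: Lnorm_def nn_integral_restrict_space indicator_def
        intro!: ennpowr_mono nn_integral_mono)
qed

lemma Lnorm_cong:
  assumes "\<And>x. x \<in> space M \<Longrightarrow> f x = g x"
  shows "Lnorm M r f = Lnorm M r g"
proof -
  have "esssup M f = esssup M g"
  proof (cases "f \<in> borel_measurable M")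
    case True
    then have "g \<in> borel_measurable M" using assms measurable_cong by blast
    then show ?thesis using True assms by (intro esssup_AE_cong) auto
  next
    case False
    then have "g \<notin> borel_measurable M" using assms measurable_cong by blast
    then show ?thesis using False by (simp add: esssup_non_measurable)
  qed
  then show ?thesis
    unfolding Lnorm_def using assms by (auto cong: nn_integral_cong)
qed

text \<open>The time slice is estimated on \<open>B\<close>, which produces the small volume \<open>b\<close>, but its norm is then
  enlarged to the fixed set \<open>B0\<close>: afterwards only the time interval varies.\<close>
lemma nn_integral_box_le_mixed:
  fixes f :: "'a::euclidean_space \<times> real \<Rightarrow> ennreal"
  assumes f [measurable]: "f \<in> borel_measurable borel"
    and B: "B \<in> sets borel" "B0 \<in> sets borel" "B \<subseteq> B0" "emeasure lborel B = ennreal b" "0 < b"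
    and I: "I \<in> sets borel" "emeasure lborel I = ennreal c" "0 < c"
    and k: "0 < k" "ennreal k \<le> r" "ennreal k \<le> q"
  shows "(\<integral>\<^sup>+z. ennpowr (f z) k * indicator (B \<times> I) z \<partial>lborel) \<le>
    ennpowr (Lnorm (restrict_space lborel I) q
      (\<lambda>t. Lnorm (restrict_space lborel B0) r (\<lambda>x. f (x, t)))) k *
    ennreal (b powr gap_ratio k r * c powr gap_ratio k q)"
proof -
  let ?N = "\<lambda>t. Lnorm (restrict_space lborel B0) r (\<lambda>x. f (x, t))"
  note [measurable] = B(1,2) I(1)
  have f' [measurable]: "f \<in> borel_measurable (borel \<Otimes>\<^sub>M borel)"
    by (simp add: borel_prod)
  have N [measurable]: "?N \<in> borel_measurable borel"
    by (rule borel_measurable_Lnorm) measurable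
  have inner: "(\<integral>\<^sup>+x. ennpowr (f (x, t)) k * indicator B x \<partial>lborel)
      \<le> ennpowr (?N t) k * ennreal (b powr gap_ratio k r)" for t
  proof -
    have ft: "(\<lambda>x. f (x, t)) \<in> borel_measurable lborel" by measurable
    have "(\<integral>\<^sup>+x. ennpowr (f (x, t)) k \<partial>restrict_space lborel B)
        \<le> ennpowr (Lnorm (restrict_space lborel B) r (\<lambda>x. f (x, t))) k * ennreal (b powr gap_ratio k r)"
      using B k ft by (intro nn_integral_powr_le_Lnorm measurable_restrict_space1)
        (auto simp: space_restrict_space emeasure_restrict_space)
    also have "\<dots> \<le> ennpowr (?N t) k * ennreal (b powr gap_ratio k r)"
      using B k ft by (intro mult_right_mono ennpowr_mono Lnorm_restrict_mono) auto
    finally show ?thesis using B by (simp add: nn_integral_restrict_space)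
  qed
  have "(\<integral>\<^sup>+z. ennpowr (f z) k * indicator (B \<times> I) z \<partial>lborel) =
      (\<integral>\<^sup>+z. ennpowr (f z) k * indicator (B \<times> I) z \<partial>(lborel \<Otimes>\<^sub>M lborel))"
    by (simp add: lborel_prod)
  also have "\<dots> = (\<integral>\<^sup>+t. \<integral>\<^sup>+x. ennpowr (f (x, t)) k * indicator (B \<times> I) (x, t) \<partial>lborel \<partial>lborel)"
    by (rule lborel_pair.nn_integral_snd[symmetric]) measurable
  also have "\<dots> = (\<integral>\<^sup>+t. (\<integral>\<^sup>+x. ennpowr (f (x, t)) k * indicator B x \<partial>lborel) * indicator I t \<partial>lborel)"
    by (intro nn_integral_cong) (auto simp: indicator_def)
  also have "\<dots> \<le> (\<integral>\<^sup>+t. ennpowr (?N t) k * ennreal (b powr gap_ratio k r) * indicator I t \<partial>lborel)"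
    by (intro nn_integral_mono mult_right_mono inner) auto
  also have "\<dots> = ennreal (b powr gap_ratio k r) * (\<integral>\<^sup>+t. ennpowr (?N t) k \<partial>restrict_space lborel I)"
    using I by (simp add: nn_integral_restrict_space nn_integral_cmult[symmetric] mult_ac)
  also have "\<dots> \<le> ennreal (b powr gap_ratio k r) *
      (ennpowr (Lnorm (restrict_space lborel I) q ?N) k * ennreal (c powr gap_ratio k q))"
    using I k by (intro mult_left_mono nn_integral_powr_le_Lnorm measurable_restrict_space1)
      (auto simp: space_restrict_space emeasure_restrict_space)
  finally show ?thesis by (simp add: ennreal_mult mult_ac)
qed

text \<open>Split \<open>g\<close> at a level \<open>n\<close> above which it carries little mass, by dominated convergence; below the
  level, the integral over \<open>A\<close> is at most \<open>n\<close> times the measure of \<open>A\<close>.\<close>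
lemma nn_integral_absolutely_continuous:
  fixes g :: "'a \<Rightarrow> ennreal"
  assumes g [measurable]: "g \<in> borel_measurable M" and fin: "(\<integral>\<^sup>+x. g x \<partial>M) < \<infinity>" and "0 < e"
  shows "\<exists>\<eta>>0. \<forall>A\<in>sets M. emeasure M A \<le> ennreal \<eta> \<longrightarrow> (\<integral>\<^sup>+x. g x * indicator A x \<partial>M) \<le> ennreal e"
proof -
  let ?u = "\<lambda>(i::nat) x. g x * indicator {x \<in> space M. of_nat i < g x} x"
  have "(\<lambda>i. \<integral>\<^sup>+x. ?u i x \<partial>M) \<longlonglongrightarrow> (\<integral>\<^sup>+x. 0 \<partial>M)"
  proof (rule nn_integral_dominated_convergence[where w=g])
    have "AE x in M. g x \<noteq> \<infinity>"
      using fin by (intro nn_integral_PInf_AE) auto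
    then show "AE x in M. (\<lambda>i. ?u i x) \<longlonglongrightarrow> 0"
    proof eventually_elim
      fix x assume "g x \<noteq> \<infinity>"
      then obtain n where n: "g x \<le> of_nat n"
        using ennreal_Ex_less_of_nat[of "g x"] by (auto simp: less_top[symmetric] intro: less_imp_le)
      have "?u i x = 0" if "n \<le> i" for i
        using n that order.trans[OF n, of "of_nat i"] by (auto simp: indicator_def not_less)
      then have "eventually (\<lambda>i. ?u i x = 0) sequentially"
        by (auto simp: eventually_sequentially)
      then show "(\<lambda>i. ?u i x) \<longlonglongrightarrow> 0" by (rule tendsto_eventually)
    qed
  qed (use fin in \<open>auto simp: indicator_def\<close>)
  then have "eventually (\<lambda>i. (\<integral>\<^sup>+x. ?u i x \<partial>M) < ennreal (e / 2)) sequentially"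
    using \<open>0 < e\<close> by (intro order_tendstoD(2)) (auto simp: ennreal_zero_less_divide)
  then obtain n where n: "(\<integral>\<^sup>+x. ?u n x \<partial>M) < ennreal (e / 2)"
    by (auto simp: eventually_sequentially)
  define \<eta> where "\<eta> = e / (2 * (real n + 1))"
  have "(\<integral>\<^sup>+x. g x * indicator A x \<partial>M) \<le> ennreal e"
    if A [measurable]: "A \<in> sets M" and le: "emeasure M A \<le> ennreal \<eta>" for A
  proof -
    have "(\<integral>\<^sup>+x. g x * indicator A x \<partial>M) \<le> (\<integral>\<^sup>+x. of_nat n * indicator A x + ?u n x \<partial>M)"
      using sets.sets_into_space[OF A]
      by (intro nn_integral_mono) (auto simp: indicator_def not_less)
    also have "\<dots> = of_nat n * emeasure M A + (\<integral>\<^sup>+x. ?u n x \<partial>M)"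
      by (subst nn_integral_add) (auto simp: nn_integral_cmult_indicator)
    also have "\<dots> \<le> ennreal (real n) * ennreal \<eta> + ennreal (e / 2)"
      using le n by (intro add_mono mult_mono) (auto simp: ennreal_of_nat_eq_real_of_nat)
    also have "\<dots> = ennreal (real n * \<eta> + e / 2)"
      using \<open>0 < e\<close> by (simp add: \<eta>_def ennreal_mult'[symmetric] ennreal_plus[symmetric] del: ennreal_plus)
    also have "\<dots> \<le> ennreal e"
      using \<open>0 < e\<close> by (intro ennreal_leI) (simp add: \<eta>_def field_simps)
    finally show ?thesis .
  qed
  moreover have "0 < \<eta>" using \<open>0 < e\<close> by (simp add: \<eta>_def)
  ultimately show ?thesis by blast
qed

lemma Lnorm_small_on_short_sets:
  assumes h [measurable]: "h \<in> borel_measurable lborel" and J: "J \<in> sets lborel"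
    and q: "1 \<le> q" "q < \<infinity>" and fin: "Lnorm (restrict_space lborel J) q h < \<infinity>" and "0 < e"
  shows "\<exists>\<eta>>0. \<forall>I\<in>sets lborel. I \<subseteq> J \<longrightarrow> emeasure lborel I \<le> ennreal \<eta> \<longrightarrow>
    Lnorm (restrict_space lborel I) q h \<le> ennreal e"
proof -
  define Q where "Q = enn2real q"
  have Q: "1 \<le> Q" using q unfolding Q_def by (cases q) (auto simp: ennreal_1[symmetric] simp del: ennreal_1)
  have L: "Lnorm (restrict_space lborel I) q h =
      ennpowr (\<integral>\<^sup>+x. ennpowr (h x) Q * indicator I x \<partial>lborel) (1 / Q)" if "I \<in> sets lborel" for I
    using that q less_irrefl[of q] by (auto simp: Lnorm_def Q_def nn_integral_restrict_space)
  have "(\<integral>\<^sup>+x. ennpowr (h x) Q * indicator J x \<partial>lborel) < \<infinity>"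
    using fin unfolding L[OF J]
    by (cases "\<integral>\<^sup>+x. ennpowr (h x) Q * indicator J x \<partial>lborel") auto
  with nn_integral_absolutely_continuous[of "\<lambda>x. ennpowr (h x) Q * indicator J x" lborel "e powr Q"]
    \<open>0 < e\<close> J
  obtain \<eta> where \<eta>: "0 < \<eta>" and small: "\<And>I. I \<in> sets lborel \<Longrightarrow> emeasure lborel I \<le> ennreal \<eta> \<Longrightarrow>
      (\<integral>\<^sup>+x. ennpowr (h x) Q * indicator J x * indicator I x \<partial>lborel) \<le> ennreal (e powr Q)"
    by auto
  have "Lnorm (restrict_space lborel I) q h \<le> ennreal e"
    if I: "I \<in> sets lborel" "I \<subseteq> J" "emeasure lborel I \<le> ennreal \<eta>" for I
  proof -
    have "(\<integral>\<^sup>+x. ennpowr (h x) Q * indicator I x \<partial>lborel) \<le> ennreal (e powr Q)"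
      using small[OF I(1,3)] I(2)
      by (auto simp: indicator_def subset_iff elim!: order.trans[rotated] intro!: nn_integral_mono)
    then have "Lnorm (restrict_space lborel I) q h \<le> ennpowr (ennreal (e powr Q)) (1 / Q)"
      unfolding L[OF I(1)] using Q by (intro ennpowr_mono) auto
    also have "\<dots> = ennreal e"
      using Q \<open>0 < e\<close> by (simp add: ennpowr_ennreal powr_powr)
    finally show ?thesis .
  qed
  with \<eta> show ?thesis by blast
qed

text \<open>Extending \<open>v\<close> by zero to the whole space-time makes it Borel measurable without changing the norms over
  boxes in \<open>X\<close>, so that the estimates for globally measurable functions apply.\<close>
lemma mixed_norm_eq_extension:
  fixes v :: "'a::euclidean_space \<times> real \<Rightarrow> 'b::real_normed_vector"
  assumes "B \<times> I \<subseteq> X" "B \<in> sets borel" "I \<in> sets borel"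
  shows "mixed_norm q r I B v = Lnorm (restrict_space lborel I) q
    (\<lambda>t. Lnorm (restrict_space lborel B) r (\<lambda>x. ennreal (norm (v (x, t))) * indicator X (x, t)))"
  unfolding mixed_norm_def
  using assms by (intro Lnorm_cong) (auto simp: space_restrict_space indicator_def)

lemma
  fixes v :: "'a::euclidean_space \<times> real \<Rightarrow> 'b::{real_normed_vector, second_countable_topology}"
  assumes v: "v \<in> borel_measurable (restrict_space borel X)" and X: "X \<in> sets borel"
    and B: "B \<in> sets borel" and J: "J \<in> sets borel" and BJ: "B \<times> J \<subseteq> X"
  shows mixed_norm_mono: "I \<in> sets borel \<Longrightarrow> I \<subseteq> J \<Longrightarrow> mixed_norm q r I B v \<le> mixed_norm q r J B v"
    and mixed_norm_small: "1 \<le> q \<Longrightarrow> q < \<infinity> \<Longrightarrow> mixed_norm q r J B v < \<infinity> \<Longrightarrow> 0 < e \<Longrightarrow>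
      \<exists>\<eta>>0. \<forall>I\<in>sets borel. I \<subseteq> J \<longrightarrow> emeasure lborel I \<le> ennreal \<eta> \<longrightarrow> mixed_norm q r I B v \<le> ennreal e"
    and nn_integral_box_le_mixed_norm: "A \<in> sets borel \<Longrightarrow> A \<subseteq> B \<Longrightarrow> I \<in> sets borel \<Longrightarrow> I \<subseteq> J \<Longrightarrow>
      emeasure lborel A = ennreal b \<Longrightarrow> 0 < b \<Longrightarrow> emeasure lborel I = ennreal c \<Longrightarrow> 0 < c \<Longrightarrow>
      0 < k \<Longrightarrow> ennreal k \<le> r \<Longrightarrow> ennreal k \<le> q \<Longrightarrow>
      (\<integral>\<^sup>+z. ennreal (norm (v z) powr k) * indicator (A \<times> I) z \<partial>lborel)
        \<le> ennpowr (mixed_norm q r I B v) k * ennreal (b powr gap_ratio k r * c powr gap_ratio k q)"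
proof -
  let ?f = "\<lambda>z. ennreal (norm (v z)) * indicator X z"
  let ?h = "\<lambda>t. Lnorm (restrict_space lborel B) r (\<lambda>x. ?f (x, t))"
  have "(\<lambda>z. ennreal (norm (v z))) \<in> borel_measurable (restrict_space borel X)"
    using v by measurable
  then have f: "?f \<in> borel_measurable borel"
    using X by (subst (asm) borel_measurable_restrict_space_iff_ennreal) auto
  have h: "?h \<in> borel_measurable lborel"
    using borel_measurable_Lnorm[OF f B] by simp
  have eq: "mixed_norm q r I B v = Lnorm (restrict_space lborel I) q ?h"
    if "I \<in> sets borel" "I \<subseteq> J" for I q
    using BJ that B by (intro mixed_norm_eq_extension) auto
  show "mixed_norm q r I B v \<le> mixed_norm q r J B v" if "I \<in> sets borel" "I \<subseteq> J"
    unfolding eq[OF that] eq[OF J order.refl] using that J by (intro Lnorm_restrict_mono h) auto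
  show "\<exists>\<eta>>0. \<forall>I\<in>sets borel. I \<subseteq> J \<longrightarrow> emeasure lborel I \<le> ennreal \<eta> \<longrightarrow> mixed_norm q r I B v \<le> ennreal e"
    if "1 \<le> q" "q < \<infinity>" "mixed_norm q r J B v < \<infinity>" "0 < e"
    using Lnorm_small_on_short_sets[OF h _ that(1,2) _ that(4), of J] that(3) J
    by (simp add: eq cong: imp_cong)
  show "(\<integral>\<^sup>+z. ennreal (norm (v z) powr k) * indicator (A \<times> I) z \<partial>lborel)
        \<le> ennpowr (mixed_norm q r I B v) k * ennreal (b powr gap_ratio k r * c powr gap_ratio k q)"
    if A: "A \<in> sets borel" "A \<subseteq> B" and I: "I \<in> sets borel" "I \<subseteq> J"
      and m: "emeasure lborel A = ennreal b" "0 < b" "emeasure lborel I = ennreal c" "0 < c"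
      and k: "0 < k" "ennreal k \<le> r" "ennreal k \<le> q"
  proof -
    have "(\<integral>\<^sup>+z. ennreal (norm (v z) powr k) * indicator (A \<times> I) z \<partial>lborel)
        = (\<integral>\<^sup>+z. ennpowr (?f z) k * indicator (A \<times> I) z \<partial>lborel)"
      using A I BJ by (intro nn_integral_cong) (auto simp: indicator_def ennpowr_ennreal)
    also have "\<dots> \<le> ennpowr (mixed_norm q r I B v) k * ennreal (b powr gap_ratio k r * c powr gap_ratio k q)"
      unfolding eq[OF I] using A I B m k by (intro nn_integral_box_le_mixed f)
    finally show ?thesis .
  qed
qed

text \<open>Halving the exponents of the pressure exactly compensates for the power \<open>3 / 2\<close> in place of \<open>3\<close>.\<close>
lemma gap_ratio_half: "gap_ratio (3 / 2) (r / 2) = gap_ratio 3 r"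
proof (cases r)
  case (real a)
  then show ?thesis
    by (cases "a = 0") (simp_all add: gap_ratio_def ennreal_divide_numeral field_simps)
qed (simp add: gap_ratio_def ennreal_top_divide)

lemma half_exponent:
  assumes "3 \<le> (r::ennreal)"
  shows "ennreal (3 / 2) \<le> r / 2"
proof -
  have "ennreal (3 / 2) = 3 / 2" by (simp add: divide_ennreal[symmetric])
  also have "\<dots> \<le> r / 2" using assms by (rule divide_right_mono_ennreal)
  finally show ?thesis .
qed

lemma gap_ratio_eq: "3 \<le> q \<Longrightarrow> gap_ratio 2 q = 1 - ratio 2 q"
  by (cases q) (auto simp: gap_ratio_def ratio_def field_simps)

section \<open>The local energy identity\<close>

text \<open>The integrand of the local energy identity without its gradient term: its integral is the pairing of
  \<open>D[u] + \<nu>|\<nabla>u|\<^sup>2\<close> with \<open>\<phi>\<close>.\<close>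
definition energy_flux ::
  "real \<Rightarrow> ((real^'n) \<times> real \<Rightarrow> real^'n) \<Rightarrow> ((real^'n) \<times> real \<Rightarrow> real) \<Rightarrow>
   ((real^'n) \<times> real \<Rightarrow> real) \<Rightarrow> (real^'n) \<times> real \<Rightarrow> real" where
  "energy_flux \<nu> u p \<phi> z =
     (norm (u z))\<^sup>2 / 2 * dt \<phi> z
     + ((norm (u z))\<^sup>2 / 2 + p z) * (\<Sum>i\<in>UNIV. u z $ i * dx i \<phi> z)
     + \<nu> * ((norm (u z))\<^sup>2 / 2 * laplacian \<phi> z)"

text \<open>Each of the cases \<open>a \<le> b\<^sup>2\<close> and \<open>b\<^sup>2 \<le> a\<close> lets one of the two summands dominate.  This decouples
  the pressure from the velocity, and replaces a Hoelder inequality with three factors.\<close>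
lemma mult_le_powr_three_halves:
  fixes a b :: real
  assumes "0 \<le> a" "0 \<le> b"
  shows "a * b \<le> a powr (3 / 2) + b ^ 3"
proof (cases "a \<le> b\<^sup>2")
  case True
  then have "a * b \<le> b\<^sup>2 * b" using assms by (intro mult_right_mono)
  then show ?thesis by (simp add: power3_eq_cube power2_eq_square add_increasing)
next
  case False
  then have "b \<le> sqrt a" by (intro real_le_rsqrt) auto
  then have "a * b \<le> a * a powr (1 / 2)"
    using assms by (intro mult_left_mono) (auto simp: powr_half_sqrt)
  also have "\<dots> = a powr (3 / 2)"
    using assms False powr_add[of a 1 "1/2"] by (cases "a = 0") auto
  finally show ?thesis using assms by (simp add: add_increasing2)
qed

lemma abs_energy_flux_le:
  fixes u :: "(real^'n) \<times> real \<Rightarrow> real^'n"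
  assumes "0 \<le> \<nu>" and A: "\<bar>dt \<phi> z\<bar> \<le> A" and B: "\<And>i. \<bar>dx i \<phi> z\<bar> \<le> B" and L: "\<bar>laplacian \<phi> z\<bar> \<le> L"
  shows "\<bar>energy_flux \<nu> u p \<phi> z\<bar> \<le> (A + \<nu> * L) * norm (u z) powr 2
    + 2 * real CARD('n) * B * (norm (u z) powr 3 + \<bar>p z\<bar> powr (3 / 2))"
proof -
  let ?v = "norm (u z)" and ?n = "real CARD('n)"
  have B0: "0 \<le> B" using B[of undefined] by linarith
  have A0: "0 \<le> A" and L0: "0 \<le> L" using A L by linarith+
  have v: "?v powr 2 = ?v\<^sup>2" "?v powr 3 = ?v ^ 3"
    by (cases "?v = 0"; simp)+
  have "\<bar>\<Sum>i\<in>UNIV. u z $ i * dx i \<phi> z\<bar> \<le> (\<Sum>i\<in>(UNIV::'n set). ?v * B)"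
    using B B0 by (intro order.trans[OF sum_abs] sum_mono)
      (auto simp: abs_mult intro!: mult_mono component_le_norm_cart)
  then have S: "\<bar>\<Sum>i\<in>UNIV. u z $ i * dx i \<phi> z\<bar> \<le> ?n * ?v * B" by simp
  have 1: "\<bar>?v\<^sup>2 / 2 * dt \<phi> z\<bar> \<le> ?v\<^sup>2 * A"
    unfolding abs_mult using A A0 by (intro mult_mono) auto
  have 2: "\<bar>\<nu> * (?v\<^sup>2 / 2 * laplacian \<phi> z)\<bar> \<le> \<nu> * (?v\<^sup>2 * L)"
    unfolding abs_mult using L L0 \<open>0 \<le> \<nu>\<close> by (intro mult_mono) auto
  have "\<bar>(?v\<^sup>2 / 2 + p z) * (\<Sum>i\<in>UNIV. u z $ i * dx i \<phi> z)\<bar> \<le> (?v\<^sup>2 + \<bar>p z\<bar>) * (?n * ?v * B)"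
    unfolding abs_mult using S zero_le_power2[of ?v] by (intro mult_mono) (linarith | simp)+
  also have "\<dots> = ?n * B * (?v ^ 3 + \<bar>p z\<bar> * ?v)"
    by (simp add: algebra_simps power2_eq_square power3_eq_cube)
  also have "\<dots> \<le> ?n * B * (2 * (?v ^ 3 + \<bar>p z\<bar> powr (3 / 2)))"
  proof (intro mult_left_mono)
    show "?v ^ 3 + \<bar>p z\<bar> * ?v \<le> 2 * (?v ^ 3 + \<bar>p z\<bar> powr (3 / 2))"
      using mult_le_powr_three_halves[of "\<bar>p z\<bar>" ?v] powr_ge_zero[of "\<bar>p z\<bar>" "3 / 2"]
      unfolding distrib_left by (simp del: powr_ge_zero)
  qed (use B0 in auto)
  finally have 3: "\<bar>(?v\<^sup>2 / 2 + p z) * (\<Sum>i\<in>UNIV. u z $ i * dx i \<phi> z)\<bar>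
      \<le> 2 * ?n * B * (?v ^ 3 + \<bar>p z\<bar> powr (3 / 2))" by (simp add: mult_ac)
  have "\<bar>energy_flux \<nu> u p \<phi> z\<bar> \<le> ?v\<^sup>2 * A + 2 * ?n * B * (?v ^ 3 + \<bar>p z\<bar> powr (3 / 2)) + \<nu> * (?v\<^sup>2 * L)"
    unfolding energy_flux_def using 1 2 3 by linarith
  then show ?thesis unfolding v by (simp add: algebra_simps)
qed

lemma borel_measurable_indicator_on:
  fixes g :: "'a::topological_space \<Rightarrow> ennreal"
  assumes "g \<in> borel_measurable (restrict_space borel X)" "X \<in> sets borel" "C \<in> sets borel" "C \<subseteq> X"
  shows "(\<lambda>z. g z * indicator C z) \<in> borel_measurable borel"
proof -
  have "(\<lambda>z. (g z * indicator X z) * indicator C z) \<in> borel_measurable borel"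
    using assms by (subst (asm) borel_measurable_restrict_space_iff_ennreal) auto
  moreover have "g z * indicator X z * indicator C z = g z * indicator C z" for z
    using assms(4) by (auto simp: indicator_def)
  ultimately show ?thesis by simp
qed

lemma emeasure_total_dissipation_eq:
  fixes G :: "(real^'n) \<times> real \<Rightarrow> real^'n^'n"
  assumes radon: "radon_on X D" and X: "X \<in> sets borel"
    and G [measurable]: "G \<in> borel_measurable (restrict_space borel X)"
    and C: "C \<in> sets borel" "C \<subseteq> X"
  shows "emeasure (total_dissipation \<nu> X G D) C =
    emeasure D C + (\<integral>\<^sup>+z\<in>C. ennreal (\<nu> * (norm (G z))\<^sup>2) \<partial>lborel)"
proof -
  let ?R = "restrict_space borel X" and ?g = "\<lambda>z. ennreal (\<nu> * (norm (G z))\<^sup>2)"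
  have CX: "C \<in> sets ?R" using C X by (simp add: sets_restrict_space_iff)
  have gm: "?g \<in> borel_measurable ?R" by measurable
  have "sets (restrict_space lborel X) = sets ?R" by (simp add: sets_restrict_space)
  then have "emeasure (density (restrict_space lborel X) ?g) C
      = (\<integral>\<^sup>+z. ?g z * indicator C z \<partial>restrict_space lborel X)"
    using CX gm by (intro emeasure_density)
      (auto simp: measurable_cong_sets[OF _ refl, of "restrict_space lborel X" ?R])
  also have "\<dots> = (\<integral>\<^sup>+z. ?g z * indicator C z * indicator X z \<partial>lborel)"
    using X by (simp add: nn_integral_restrict_space)
  also have "\<dots> = (\<integral>\<^sup>+z\<in>C. ?g z \<partial>lborel)"
    using C(2) by (intro nn_integral_cong) (auto simp: indicator_def)
  finally show ?thesis by (simp add: emeasure_total_dissipation[OF radon CX])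
qed

text \<open>The gradient term has a sign and is moved to the side of \<open>D[u]\<close>, where both contributions are bounded
  below by \<open>c\<close> times their mass on \<open>C\<close>.\<close>
lemma total_dissipation_le_flux:
  fixes u :: "(real^'n) \<times> real \<Rightarrow> real^'n" and G :: "(real^'n) \<times> real \<Rightarrow> real^'n^'n"
  assumes D: "dissipation_measure \<nu> X u G p D" and X: "X \<in> sets borel" and \<nu>: "0 \<le> \<nu>"
    and u: "u \<in> borel_measurable (restrict_space borel X)"
    and p: "p \<in> borel_measurable (restrict_space borel X)"
    and G: "in_L2 X G"
    and \<phi>: "test_function X \<phi>" "\<And>z. 0 \<le> \<phi> z" "\<And>z. \<phi> z \<le> 1"
    and W: "W \<in> borel_measurable borel" "\<And>z. z \<in> X \<Longrightarrow> \<bar>energy_flux \<nu> u p \<phi> z\<bar> \<le> W z"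
    and fin: "(\<integral>\<^sup>+z. ennreal (W z) \<partial>lborel) < \<infinity>"
    and C: "C \<in> sets borel" "C \<subseteq> X" "0 \<le> c" "\<And>z. z \<in> C \<Longrightarrow> c \<le> \<phi> z"
  shows "ennreal c * emeasure (total_dissipation \<nu> X G D) C \<le> (\<integral>\<^sup>+z. ennreal (W z) \<partial>lborel)"
proof -
  let ?R = "restrict_space borel X"
  let ?P = "\<lambda>z. indicator X z *\<^sub>R energy_flux \<nu> u p \<phi> z"
  let ?Q = "\<lambda>z. indicator X z *\<^sub>R (\<nu> * (norm (G z))\<^sup>2 * \<phi> z)"
  have smooth: "smooth_on UNIV \<phi>" using \<phi>(1) by (simp add: test_function_def)
  have cont: "f \<in> borel_measurable borel" if "smooth_on UNIV f" for f :: "(real^'n) \<times> real \<Rightarrow> real"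
    using smooth_continuous[OF that] by (rule borel_measurable_continuous_onI)
  have r: "f \<in> borel_measurable ?R" if "f \<in> borel_measurable borel" for f :: "_ \<Rightarrow> real"
    using that by (rule measurable_restrict_space1)
  have [measurable]: "dt \<phi> \<in> borel_measurable ?R" "\<And>i. dx i \<phi> \<in> borel_measurable ?R"
    "\<And>i. dx i (dx i \<phi>) \<in> borel_measurable ?R" "\<phi> \<in> borel_measurable ?R"
    using smooth by (intro r cont smooth_dt smooth_dx; simp)+
  have [measurable]: "laplacian \<phi> \<in> borel_measurable ?R"
    unfolding laplacian_def by measurable
  have Gm [measurable]: "G \<in> borel_measurable ?R" using G by (simp add: in_L2_def)
  note [measurable] = X C(1) W(1) u p
  have un [measurable]: "(\<lambda>z. u z $ i) \<in> borel_measurable ?R" for i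
  proof -
    have "(\<lambda>z. u z \<bullet> axis i 1) \<in> borel_measurable ?R" by measurable
    then show ?thesis by (simp add: inner_axis)
  qed
  have Pm: "?P \<in> borel_measurable borel"
  proof -
    have "energy_flux \<nu> u p \<phi> \<in> borel_measurable ?R"
      unfolding energy_flux_def[abs_def]
      by measurable
    then show ?thesis using X by (subst (asm) borel_measurable_restrict_space_iff) auto
  qed
  have Qm: "?Q \<in> borel_measurable borel"
  proof -
    have "(\<lambda>z. \<nu> * (norm (G z))\<^sup>2 * \<phi> z) \<in> borel_measurable ?R"
      by measurable
    then show ?thesis using X by (subst (asm) borel_measurable_restrict_space_iff) auto
  qed
  have PW: "ennreal (norm (?P z)) \<le> ennreal (W z)" for z
    using W(2)[of z] by (cases "z \<in> X") (auto intro: ennreal_leI)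
  have IP: "integrable lborel ?P"
    using Pm fin nn_integral_mono[of lborel "\<lambda>z. ennreal (norm (?P z))" "\<lambda>z. ennreal (W z)"] PW
    by (intro integrableI_bounded) (auto elim: order.strict_trans1)
  have Q0: "0 \<le> ?Q z" for z using \<nu> \<phi>(2) by simp
  have IQ: "integrable lborel ?Q"
  proof (rule integrableI_bounded)
    have "(\<integral>\<^sup>+z. ennreal (norm (?Q z)) \<partial>lborel)
        \<le> (\<integral>\<^sup>+z. ennreal \<nu> * (ennreal ((norm (G z))\<^sup>2) * indicator X z) \<partial>lborel)"
    proof (rule nn_integral_mono)
      fix z
      have "\<nu> * (norm (G z))\<^sup>2 * \<phi> z \<le> \<nu> * (norm (G z))\<^sup>2"
        using \<nu> \<phi>(2,3)[of z] by (intro mult_left_le) auto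
      then show "ennreal (norm (?Q z)) \<le> ennreal \<nu> * (ennreal ((norm (G z))\<^sup>2) * indicator X z)"
        using \<nu> \<phi>(2)[of z] by (auto simp: indicator_def ennreal_mult'[symmetric] abs_mult intro!: ennreal_leI)
    qed
    also have "\<dots> = ennreal \<nu> * (\<integral>\<^sup>+z\<in>X. ennreal ((norm (G z))\<^sup>2) \<partial>lborel)"
    proof (rule nn_integral_cmult)
      have "(\<lambda>z. ennreal ((norm (G z))\<^sup>2)) \<in> borel_measurable ?R" by measurable
      then show "(\<lambda>z. ennreal ((norm (G z))\<^sup>2) * indicator X z) \<in> borel_measurable lborel"
        using X by (subst (asm) borel_measurable_restrict_space_iff_ennreal) auto
    qed
    also have "\<dots> < \<infinity>" using G by (simp add: in_L2_def ennreal_mult_less_top)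
    finally show "(\<integral>\<^sup>+z. ennreal (norm (?Q z)) \<partial>lborel) < \<infinity>" .
  qed (use Qm in simp)
  have radon: "radon_on X D" using D by (simp add: dissipation_measure_def)
  have setsD: "sets D = sets ?R" using radon by (simp add: radon_on_def)
  have "integrable D \<phi>"
  proof (rule integrableI_bounded)
    show "\<phi> \<in> borel_measurable D"
      using r[OF cont[OF smooth]] by (simp cong: measurable_cong_sets add: measurable_cong_sets[OF setsD refl])
    let ?S = "closure {z. \<phi> z \<noteq> 0}"
    have S: "compact ?S" "?S \<subseteq> X" using \<phi>(1) by (auto simp: test_function_def)
    have "z \<in> ?S" if "\<phi> z \<noteq> 0" for z
      using that closure_subset[of "{z. \<phi> z \<noteq> 0}"] by auto
    then have "(\<integral>\<^sup>+z. ennreal (norm (\<phi> z)) \<partial>D) \<le> (\<integral>\<^sup>+z. indicator ?S z \<partial>D)"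
      using \<phi>(2,3) by (intro nn_integral_mono) (auto simp: indicator_def ennreal_le_1)
    also have "\<dots> = emeasure D ?S"
      using S X by (intro nn_integral_indicator) (auto simp: setsD sets_restrict_space_iff)
    also have "\<dots> < \<infinity>" using radon S by (auto simp: radon_on_def)
    finally show "(\<integral>\<^sup>+z. ennreal (norm (\<phi> z)) \<partial>D) < \<infinity>" .
  qed
  then have D\<phi>: "(\<integral>\<^sup>+z. ennreal (\<phi> z) \<partial>D) = ennreal (LINT z|D. \<phi> z)"
    using \<phi>(2) by (intro nn_integral_eq_integral) auto
  have "(LINT z|D. \<phi> z) = dissipation \<nu> X u G p \<phi>"
    using D \<phi>(1) by (simp add: dissipation_measure_def)
  also have "\<dots> = (LINT z|lborel. ?P z - ?Q z)"
    unfolding dissipation_def set_lebesgue_integral_def energy_flux_def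
    by (intro Bochner_Integration.integral_cong) (auto simp: algebra_simps)
  also have "\<dots> = (LINT z|lborel. ?P z) - (LINT z|lborel. ?Q z)"
    using IP IQ by (rule Bochner_Integration.integral_diff)
  finally have eq: "(LINT z|D. \<phi> z) + (LINT z|lborel. ?Q z) = (LINT z|lborel. ?P z)" by simp
  have CX: "C \<in> sets ?R" using C X by (simp add: sets_restrict_space_iff)
  have "ennreal c * emeasure D C = (\<integral>\<^sup>+z. ennreal c * indicator C z \<partial>D)"
    using CX by (subst nn_integral_cmult_indicator) (auto simp: setsD)
  also have "\<dots> \<le> (\<integral>\<^sup>+z. ennreal (\<phi> z) \<partial>D)"
    using C(4) by (intro nn_integral_mono) (auto simp: indicator_def intro: ennreal_leI)
  finally have le1: "ennreal c * emeasure D C \<le> ennreal (LINT z|D. \<phi> z)" unfolding D\<phi> .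
  let ?g = "\<lambda>z. ennreal (\<nu> * (norm (G z))\<^sup>2)"
  have "ennreal c * (\<integral>\<^sup>+z\<in>C. ?g z \<partial>lborel) = (\<integral>\<^sup>+z. ennreal c * (?g z * indicator C z) \<partial>lborel)"
    using borel_measurable_indicator_on[OF _ X C(1,2), of ?g] Gm
    by (intro nn_integral_cmult[symmetric]) simp
  also have "\<dots> \<le> (\<integral>\<^sup>+z. ennreal (?Q z) \<partial>lborel)"
  proof (rule nn_integral_mono)
    fix z
    show "ennreal c * (?g z * indicator C z) \<le> ennreal (?Q z)"
    proof (cases "z \<in> C")
      case True
      then have "c * (\<nu> * (norm (G z))\<^sup>2) \<le> \<phi> z * (\<nu> * (norm (G z))\<^sup>2)"
        using C(4) \<nu> by (intro mult_right_mono) auto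
      then show ?thesis using True C(2,3) by (auto simp: ennreal_mult'[symmetric] mult_ac intro!: ennreal_leI)
    qed simp
  qed
  also have "\<dots> = ennreal (LINT z|lborel. ?Q z)"
    using IQ Q0 by (intro nn_integral_eq_integral) auto
  finally have le2: "ennreal c * (\<integral>\<^sup>+z\<in>C. ?g z \<partial>lborel) \<le> ennreal (LINT z|lborel. ?Q z)" .
  have "ennreal c * emeasure (total_dissipation \<nu> X G D) C
      = ennreal c * emeasure D C + ennreal c * (\<integral>\<^sup>+z\<in>C. ?g z \<partial>lborel)"
    by (simp add: emeasure_total_dissipation_eq[OF radon X Gm C(1,2)] distrib_left)
  also have "\<dots> \<le> ennreal (LINT z|D. \<phi> z) + ennreal (LINT z|lborel. ?Q z)"
    by (intro add_mono le1 le2)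
  also have "\<dots> = ennreal (LINT z|lborel. ?P z)"
    unfolding eq[symmetric] using Q0 \<phi>(2)
    by (intro ennreal_plus[symmetric] Bochner_Integration.integral_nonneg)
  also have "\<dots> \<le> ennreal (norm (LINT z|lborel. ?P z))" by (intro ennreal_leI) simp
  also have "\<dots> \<le> (\<integral>\<^sup>+z. ennreal (norm (?P z)) \<partial>lborel)"
    by (rule integral_norm_bound_ennreal[OF IP])
  also have "\<dots> \<le> (\<integral>\<^sup>+z. ennreal (W z) \<partial>lborel)" by (intro nn_integral_mono PW)
  finally show ?thesis .
qed

section \<open>Scaling of the dissipation on cylinders\<close>

text \<open>Both sides are homogeneous in \<open>\<delta>\<close>; the surplus power of \<open>\<delta>\<close> over \<open>s\<close> is non-negative and is
  absorbed into a power of \<open>d0\<close>.  The base \<open>a * (2 * \<delta>) ^ d\<close> is the volume of a ball of radius \<open>2 * \<delta>\<close>,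
  and \<open>2 * (2 * \<delta>) powr \<alpha>\<close> the length of its time interval.\<close>
lemma box_volume_scaling:
  fixes \<delta> d0 s l a w g h \<alpha> :: real
  assumes \<delta>: "0 < \<delta>" "\<delta> \<le> d0" and "0 < a" and s: "s \<le> - l + real d * g + \<alpha> * h"
  shows "\<delta> powr (- l) * ((a * (2 * \<delta>) ^ d) powr g * (2 * (2 * \<delta>) powr \<alpha>) powr h)
    \<le> ((a * 2 ^ d) powr g * (2 * 2 powr \<alpha>) powr h * d0 powr (- l + real d * g + \<alpha> * h - s)) * \<delta> powr s"
proof -
  let ?k = "(a * 2 ^ d) powr g * (2 * 2 powr \<alpha>) powr h"
  let ?e = "- l + real d * g + \<alpha> * h"
  have 1: "(a * (2 * \<delta>) ^ d) powr g = (a * 2 ^ d) powr g * \<delta> powr (real d * g)"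
    using \<delta> \<open>0 < a\<close> by (simp add: power_mult_distrib powr_mult powr_powr powr_realpow[symmetric])
  have 2: "(2 * (2 * \<delta>) powr \<alpha>) powr h = (2 * 2 powr \<alpha>) powr h * \<delta> powr (\<alpha> * h)"
    using \<delta> by (simp add: powr_mult powr_powr)
  have "\<delta> powr (- l) * ((a * (2 * \<delta>) ^ d) powr g * (2 * (2 * \<delta>) powr \<alpha>) powr h)
      = ?k * (\<delta> powr (- l) * \<delta> powr (real d * g) * \<delta> powr (\<alpha> * h))"
    unfolding 1 2 by simp
  also have "\<dots> = ?k * (\<delta> powr (?e - s) * \<delta> powr s)"
    by (simp add: powr_add[symmetric])
  also have "\<dots> \<le> ?k * (d0 powr (?e - s) * \<delta> powr s)"
    using \<delta> s by (intro mult_left_mono mult_right_mono powr_mono2) auto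
  finally show ?thesis by (simp add: mult_ac)
qed

text \<open>The central estimate.  Its point is the separation of the scale factor \<open>\<delta> powr s\<close> from \<open>E\<close>, which
  depends on the cylinder only through its time interval.\<close>
lemma cylinder_dissipation_le:
  fixes u :: "(real^'n) \<times> real \<Rightarrow> real^'n" and G :: "(real^'n) \<times> real \<Rightarrow> real^'n^'n"
    and p :: "(real^'n) \<times> real \<Rightarrow> real" and \<nu> \<alpha> d0 :: real and q r :: ennreal
  assumes D: "dissipation_measure \<nu> X u G p D" and X: "X \<in> sets borel" and \<nu>: "0 \<le> \<nu>"
    and G: "in_L2 X G"
    and u: "u \<in> borel_measurable (restrict_space borel X)"
    and p: "p \<in> borel_measurable (restrict_space borel X)"
    and B: "B \<in> sets borel" and J: "J \<in> sets borel" and BJ: "B \<times> J \<subseteq> X"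
    and r: "3 \<le> r" and q: "3 \<le> q" and \<alpha>: "0 < \<alpha>"
    and u_fin: "mixed_norm q r J B u < \<infinity>" and p_fin: "mixed_norm (q / 2) (r / 2) J B p < \<infinity>"
  defines "E \<equiv> \<lambda>I. ennpowr (mixed_norm q r I B u) 2 + ennpowr (mixed_norm q r I B u) 3
      + ennpowr (mixed_norm (q / 2) (r / 2) I B p) (3 / 2)"
  shows "\<exists>C\<ge>0. \<forall>x t \<delta>. 0 < \<delta> \<longrightarrow> \<delta> \<le> d0 \<longrightarrow> cball x (2 * \<delta>) \<subseteq> B \<longrightarrow>
    {t - (2 * \<delta>) powr \<alpha> .. t + (2 * \<delta>) powr \<alpha>} \<subseteq> J \<longrightarrow>
    emeasure (total_dissipation \<nu> X G D) (cylinder \<alpha> \<delta> x t) \<le>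
      ennreal (C * \<delta> powr scaling_exponent CARD('n) \<alpha> r q) * E {t - (2 * \<delta>) powr \<alpha> .. t + (2 * \<delta>) powr \<alpha>}"
proof -
  let ?d = "CARD('n)"
  define s where "s = scaling_exponent ?d \<alpha> r q"
  obtain c M where c: "0 < c" and M: "0 \<le> M"
    and cutoff: "\<And>(x::real^'n) t \<delta>. 0 < \<delta> \<Longrightarrow> \<exists>\<phi>.
      smooth_on UNIV \<phi> \<and> (\<forall>z. 0 \<le> \<phi> z \<and> \<phi> z \<le> 1) \<and> (\<forall>z\<in>cylinder \<alpha> \<delta> x t. c \<le> \<phi> z) \<and>
      (\<forall>z. z \<notin> cball x (2 * \<delta>) \<times> {t - (2 * \<delta>) powr \<alpha> .. t + (2 * \<delta>) powr \<alpha>} \<longrightarrow> \<phi> z = 0) \<and>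
      (\<forall>z. \<bar>dt \<phi> z\<bar> \<le> M / \<delta> powr \<alpha> \<and> (\<forall>i. \<bar>dx i \<phi> z\<bar> \<le> M / \<delta>) \<and> \<bar>laplacian \<phi> z\<bar> \<le> M / \<delta>\<^sup>2)"
    using cutoff_exists[OF \<alpha>, where 'n = 'n] by blast
  define \<beta> where "\<beta> = unit_ball_vol (real ?d)"
  have \<beta>: "0 < \<beta>" by (simp add: \<beta>_def)
  define k where "k l g h = (\<beta> * 2 ^ ?d) powr g * (2 * 2 powr \<alpha>) powr h * d0 powr (- l + real ?d * g + \<alpha> * h - s)"
    for l g h
  have k0: "0 \<le> k l g h" for l g h by (simp add: k_def)
  define vol where "vol \<delta> g h = (\<beta> * (2 * \<delta>) ^ ?d) powr g * (2 * (2 * \<delta>) powr \<alpha>) powr h" for \<delta> g h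
  have vol0: "0 \<le> vol \<delta> g h" for \<delta> g h by (simp add: vol_def)
  have vol: "\<delta> powr (- l) * vol \<delta> g h \<le> k l g h * \<delta> powr s"
    if "0 < \<delta>" "\<delta> \<le> d0" "s \<le> - l + real ?d * g + \<alpha> * h" for \<delta> l g h
    unfolding vol_def k_def using that \<beta> by (intro box_volume_scaling)
  \<comment> \<open>The three competitors in the scaling exponent belong to the time derivative, the gradient and the
    Laplacian of the cutoff.\<close>
  have s1: "s \<le> - \<alpha> + real ?d * gap_ratio 2 r + \<alpha> * gap_ratio 2 q"
    and s2: "s \<le> - 1 + real ?d * gap_ratio 3 r + \<alpha> * gap_ratio 3 q"
    and s3: "s \<le> - 2 + real ?d * gap_ratio 2 r + \<alpha> * gap_ratio 2 q"
    by (auto simp: s_def scaling_exponent_def gap_ratio_eq[OF q] algebra_simps)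
  define C1 where "C1 = M * k \<alpha> (gap_ratio 2 r) (gap_ratio 2 q) + \<nu> * M * k 2 (gap_ratio 2 r) (gap_ratio 2 q)"
  define C2 where "C2 = 2 * real ?d * M * k 1 (gap_ratio 3 r) (gap_ratio 3 q)"
  have C0: "0 \<le> C1" "0 \<le> C2" using M \<nu> k0 by (auto simp: C1_def C2_def)
  have "emeasure (total_dissipation \<nu> X G D) (cylinder \<alpha> \<delta> x t) \<le>
      ennreal ((C1 + C2) / c * \<delta> powr s) * E {t - (2 * \<delta>) powr \<alpha> .. t + (2 * \<delta>) powr \<alpha>}"
    if \<delta>: "0 < \<delta>" "\<delta> \<le> d0" and xB: "cball x (2 * \<delta>) \<subseteq> B"
      and IJ: "{t - (2 * \<delta>) powr \<alpha> .. t + (2 * \<delta>) powr \<alpha>} \<subseteq> J" for x :: "real^'n" and t \<delta> :: real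
  proof -
    define I where "I = {t - (2 * \<delta>) powr \<alpha> .. t + (2 * \<delta>) powr \<alpha>}"
    define S where "S = cball x (2 * \<delta>) \<times> I"
    have I: "I \<in> sets borel" "I \<subseteq> J" using IJ by (auto simp: I_def)
    have S: "compact S" "S \<subseteq> X" using xB IJ BJ by (auto simp: S_def I_def intro!: compact_Times)
    then have Sb: "S \<in> sets borel" by (simp add: compact_imp_closed)
    obtain \<phi> where \<phi>: "smooth_on UNIV \<phi>" "\<And>z. 0 \<le> \<phi> z" "\<And>z. \<phi> z \<le> 1" "\<And>z. z \<in> cylinder \<alpha> \<delta> x t \<Longrightarrow> c \<le> \<phi> z"
      and \<phi>0: "\<And>z. z \<notin> S \<Longrightarrow> \<phi> z = 0"
      and \<phi>d: "\<And>z. \<bar>dt \<phi> z\<bar> \<le> M / \<delta> powr \<alpha>" "\<And>z i. \<bar>dx i \<phi> z\<bar> \<le> M / \<delta>" "\<And>z. \<bar>laplacian \<phi> z\<bar> \<le> M / \<delta>\<^sup>2"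
      using cutoff[OF \<delta>(1), of x t] unfolding S_def I_def by blast
    have nz: "{z. \<phi> z \<noteq> 0} \<subseteq> S" using \<phi>0 by blast
    then have supp: "closure {z. \<phi> z \<noteq> 0} \<subseteq> S"
      using S(1) by (intro closure_minimal compact_imp_closed) auto
    have test: "test_function X \<phi>"
      unfolding test_function_def using \<phi>(1) S(2) supp bounded_subset[OF compact_imp_bounded[OF S(1)] nz]
      by auto
    define A1 where "A1 = M / \<delta> powr \<alpha> + \<nu> * (M / \<delta>\<^sup>2)"
    define A2 where "A2 = 2 * real ?d * (M / \<delta>)"
    have A0: "0 \<le> A1" "0 \<le> A2" using M \<nu> \<delta> by (auto simp: A1_def A2_def)
    define g where "g z = A1 * norm (u z) powr 2 + A2 * (norm (u z) powr 3 + norm (p z) powr (3 / 2))" for z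
    define W where "W z = indicator S z * (indicator X z *\<^sub>R g z)" for z
    have "g \<in> borel_measurable (restrict_space borel X)"
      unfolding g_def[abs_def] using u p by measurable
    then have "(\<lambda>z. indicator X z *\<^sub>R g z) \<in> borel_measurable borel"
      using X by (subst (asm) borel_measurable_restrict_space_iff) auto
    then have Wm: "W \<in> borel_measurable borel"
      unfolding W_def[abs_def] using Sb by measurable
    have flux: "\<bar>energy_flux \<nu> u p \<phi> z\<bar> \<le> W z" for z
    proof (cases "z \<in> S")
      case True
      then show ?thesis
        using abs_energy_flux_le[where u = u and p = p and z = z, OF \<nu> \<phi>d(1) \<phi>d(2) \<phi>d(3)] S(2)
        by (auto simp: W_def g_def A1_def A2_def)
    next
      case False
      have "dt \<phi> z = 0" "\<And>i. dx i \<phi> z = 0" "laplacian \<phi> z = 0"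
        using derivs_eq_0_off[OF compact_imp_closed[OF S(1)], of \<phi> z] \<phi>0 False by auto
      then show ?thesis using False by (simp add: energy_flux_def W_def)
    qed
    define U where "U k = (\<integral>\<^sup>+z. ennreal (norm (u z) powr k) * indicator S z \<partial>lborel)" for k
    define P where "P = (\<integral>\<^sup>+z. ennreal (norm (p z) powr (3 / 2)) * indicator S z \<partial>lborel)"
    have um: "(\<lambda>z. ennreal (norm (u z) powr k) * indicator S z) \<in> borel_measurable borel" for k
      using u by (intro borel_measurable_indicator_on[OF _ X Sb S(2)]) measurable
    have pm: "(\<lambda>z. ennreal (norm (p z) powr (3 / 2)) * indicator S z) \<in> borel_measurable borel"
      using p by (intro borel_measurable_indicator_on[OF _ X Sb S(2)]) measurable
    have W_split: "ennreal (W z) = ennreal A1 * (ennreal (norm (u z) powr 2) * indicator S z)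
        + ennreal A2 * (ennreal (norm (u z) powr 3) * indicator S z
          + ennreal (norm (p z) powr (3 / 2)) * indicator S z)" for z
      using A0 S(2) by (auto simp: W_def g_def indicator_def ennreal_plus ennreal_mult)
    have lin: "(\<integral>\<^sup>+z. a * f1 z + b * (f2 z + f3 z) \<partial>lborel) =
        a * integral\<^sup>N lborel f1 + b * (integral\<^sup>N lborel f2 + integral\<^sup>N lborel f3)"
      if "f1 \<in> borel_measurable borel" "f2 \<in> borel_measurable borel" "f3 \<in> borel_measurable borel"
      for a b :: ennreal and f1 f2 f3 :: "(real^'n) \<times> real \<Rightarrow> ennreal"
      using that by (simp add: nn_integral_add nn_integral_cmult)
    have W_int: "(\<integral>\<^sup>+z. ennreal (W z) \<partial>lborel) = ennreal A1 * U 2 + ennreal A2 * (U 3 + P)"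
      unfolding W_split U_def P_def by (rule lin[OF um um pm])
    have ball: "emeasure lborel (cball x (2 * \<delta>)) = ennreal (\<beta> * (2 * \<delta>) ^ ?d)" "0 < \<beta> * (2 * \<delta>) ^ ?d"
      using \<delta> \<beta> by (auto simp: emeasure_cball \<beta>_def)
    have int: "emeasure lborel I = ennreal (2 * (2 * \<delta>) powr \<alpha>)" "0 < 2 * (2 * \<delta>) powr \<alpha>"
      using \<delta> by (auto simp: I_def)
    have two: "ennreal 2 \<le> r" "ennreal 2 \<le> q" "ennreal 3 \<le> r" "ennreal 3 \<le> q"
      using r q by (auto intro: order.trans[of _ 3])
    note box = nn_integral_box_le_mixed_norm[OF _ X B J BJ _ xB I ball int]
    have U2: "U 2 \<le> ennpowr (mixed_norm q r I B u) 2 * ennreal (vol \<delta> (gap_ratio 2 r) (gap_ratio 2 q))"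
      unfolding U_def S_def vol_def using two by (intro box u) auto
    have U3: "U 3 \<le> ennpowr (mixed_norm q r I B u) 3 * ennreal (vol \<delta> (gap_ratio 3 r) (gap_ratio 3 q))"
      unfolding U_def S_def vol_def using two by (intro box u) auto
    have P: "P \<le> ennpowr (mixed_norm (q / 2) (r / 2) I B p) (3 / 2)
        * ennreal (vol \<delta> (gap_ratio 3 r) (gap_ratio 3 q))"
      unfolding P_def S_def vol_def gap_ratio_half[symmetric, of r] gap_ratio_half[symmetric, of q]
      using half_exponent[OF r] half_exponent[OF q] by (intro box p) auto
    have fin: "mixed_norm q r I B u < top" "mixed_norm (q / 2) (r / 2) I B p < top"
      using order.strict_trans1[OF mixed_norm_mono[OF u X B J BJ I] u_fin]
        order.strict_trans1[OF mixed_norm_mono[OF p X B J BJ I] p_fin] by auto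
    have "U 2 < top" "U 3 < top" "P < top"
      using fin by (auto simp: ennreal_mult_less_top ennpowr_less_top intro: order.strict_trans1[OF U2]
          order.strict_trans1[OF U3] order.strict_trans1[OF P])
    then have "(\<integral>\<^sup>+z. ennreal (W z) \<partial>lborel) < \<infinity>"
      unfolding W_int by (simp add: ennreal_mult_less_top)
    then have "ennreal c * emeasure (total_dissipation \<nu> X G D) (cylinder \<alpha> \<delta> x t)
        \<le> (\<integral>\<^sup>+z. ennreal (W z) \<partial>lborel)"
    proof (intro total_dissipation_le_flux[OF D X \<nu> u p G test \<phi>(2,3) Wm flux _ _ _ less_imp_le[OF c] \<phi>(4)])
      show "cylinder \<alpha> \<delta> x t \<in> sets borel"
        unfolding cylinder_def by (intro borel_open open_Times) auto
      have "\<delta> powr \<alpha> \<le> (2 * \<delta>) powr \<alpha>" using \<delta> \<alpha> by (intro powr_mono2) auto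
      then have "cylinder \<alpha> \<delta> x t \<subseteq> S" using \<delta> by (auto simp: cylinder_def S_def I_def)
      then show "cylinder \<alpha> \<delta> x t \<subseteq> X" using S(2) by blast
    qed auto
    also have "\<dots> \<le> ennreal ((C1 + C2) * \<delta> powr s) * E I"
    proof -
      have a1: "A1 * vol \<delta> (gap_ratio 2 r) (gap_ratio 2 q) \<le> C1 * \<delta> powr s"
      proof -
        have "A1 = M * \<delta> powr (- \<alpha>) + \<nu> * M * \<delta> powr (- 2)"
          using \<delta> by (simp add: A1_def powr_minus_divide)
        then show ?thesis
          using mult_left_mono[OF vol[OF \<delta> s1] M] mult_left_mono[OF vol[OF \<delta> s3], of "\<nu> * M"] M \<nu>
          by (simp add: C1_def algebra_simps)
      qed
      have a2: "A2 * vol \<delta> (gap_ratio 3 r) (gap_ratio 3 q) \<le> C2 * \<delta> powr s"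
      proof -
        have "A2 = 2 * real ?d * M * \<delta> powr (- 1)"
          using \<delta> by (simp add: A2_def powr_minus_divide)
        then show ?thesis
          using mult_left_mono[OF vol[OF \<delta> s2], of "2 * real ?d * M"] M
          by (simp add: C2_def algebra_simps)
      qed
      let ?n2 = "ennpowr (mixed_norm q r I B u) 2" and ?n3 = "ennpowr (mixed_norm q r I B u) 3"
        and ?np = "ennpowr (mixed_norm (q / 2) (r / 2) I B p) (3 / 2)"
      have "ennreal A1 * U 2 \<le> ennreal A1 * (?n2 * ennreal (vol \<delta> (gap_ratio 2 r) (gap_ratio 2 q)))"
        by (intro mult_left_mono U2) auto
      also have "\<dots> = ennreal (A1 * vol \<delta> (gap_ratio 2 r) (gap_ratio 2 q)) * ?n2"
        using A0 vol0 by (simp add: ennreal_mult mult_ac)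
      also have "\<dots> \<le> ennreal ((C1 + C2) * \<delta> powr s) * ?n2"
        using a1 C0 by (intro mult_right_mono ennreal_leI) (auto simp: algebra_simps intro: add_increasing2)
      finally have 1: "ennreal A1 * U 2 \<le> ennreal ((C1 + C2) * \<delta> powr s) * ?n2" .
      have "ennreal A2 * (U 3 + P) \<le> ennreal A2 * ((?n3 + ?np) * ennreal (vol \<delta> (gap_ratio 3 r) (gap_ratio 3 q)))"
        unfolding distrib_right by (intro mult_left_mono add_mono U3 P) auto
      also have "\<dots> = ennreal (A2 * vol \<delta> (gap_ratio 3 r) (gap_ratio 3 q)) * (?n3 + ?np)"
        using A0 vol0 by (simp add: ennreal_mult mult_ac)
      also have "\<dots> \<le> ennreal ((C1 + C2) * \<delta> powr s) * (?n3 + ?np)"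
        using a2 C0 by (intro mult_right_mono ennreal_leI) (auto simp: algebra_simps intro: add_increasing)
      finally have 2: "ennreal A2 * (U 3 + P) \<le> ennreal ((C1 + C2) * \<delta> powr s) * (?n3 + ?np)" .
      have "ennreal ((C1 + C2) * \<delta> powr s) * E I
          = ennreal ((C1 + C2) * \<delta> powr s) * ?n2 + ennreal ((C1 + C2) * \<delta> powr s) * (?n3 + ?np)"
        by (simp add: E_def distrib_left add.assoc)
      then show ?thesis unfolding W_int using add_mono[OF 1 2] by simp
    qed
    finally have le: "ennreal c * emeasure (total_dissipation \<nu> X G D) (cylinder \<alpha> \<delta> x t)
        \<le> ennreal ((C1 + C2) * \<delta> powr s) * E I" .
    have "emeasure (total_dissipation \<nu> X G D) (cylinder \<alpha> \<delta> x t)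
        = ennreal (1 / c) * (ennreal c * emeasure (total_dissipation \<nu> X G D) (cylinder \<alpha> \<delta> x t))"
      using c by (simp add: mult.assoc[symmetric] ennreal_mult[symmetric])
    also have "\<dots> \<le> ennreal (1 / c) * (ennreal ((C1 + C2) * \<delta> powr s) * E I)"
      by (intro mult_left_mono le) auto
    also have "\<dots> = ennreal ((C1 + C2) / c * \<delta> powr s) * E I"
      using c C0 by (simp add: mult.assoc[symmetric] ennreal_mult[symmetric])
    finally show ?thesis unfolding I_def .
  qed
  moreover have "0 \<le> (C1 + C2) / c" using C0 c by simp
  ultimately show ?thesis unfolding s_def by blast
qed


section \<open>Uniformity over compact sets\<close>

text \<open>The modulus is the supremum of \<open>F z \<delta>' / \<delta>' powr s\<close> over all smaller scales, which is monotone by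
  construction.\<close>
lemma modulus_of_continuity_exists:
  fixes F :: "'a \<Rightarrow> real \<Rightarrow> ennreal"
  assumes bound: "\<And>z \<delta>. z \<in> K \<Longrightarrow> 0 < \<delta> \<Longrightarrow> \<delta> \<le> d0 \<Longrightarrow> F z \<delta> \<le> ennreal (C * \<delta> powr s)"
    and small: "\<And>e. 0 < e \<Longrightarrow> \<exists>\<eta>>0. \<forall>z\<in>K. \<forall>\<delta>. 0 < \<delta> \<longrightarrow> \<delta> \<le> d0 \<longrightarrow> \<delta> \<le> \<eta> \<longrightarrow>
      F z \<delta> \<le> ennreal (e * \<delta> powr s)"
  shows "\<exists>\<omega>. modulus_of_continuity \<omega> \<and>
    (\<forall>z\<in>K. \<forall>\<delta>. 0 < \<delta> \<and> \<delta> \<le> d0 \<longrightarrow> F z \<delta> \<le> ennreal (\<omega> \<delta> * \<delta> powr s))"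
proof -
  define f where "f z \<delta> = enn2real (F z \<delta>) / \<delta> powr s" for z \<delta>
  \<comment> \<open>The value \<open>0\<close> is inserted so that the supremum is meaningful and non-negative even when the rest
    of the set is empty.\<close>
  define S where "S \<delta> = insert 0 {f z \<delta>' |z \<delta>'. z \<in> K \<and> 0 < \<delta>' \<and> \<delta>' \<le> d0 \<and> \<delta>' \<le> \<delta>}" for \<delta>
  define \<omega> where "\<omega> \<delta> = Sup (S \<delta>)" for \<delta>
  have f_le: "f z \<delta> \<le> max c 0" if "F z \<delta> \<le> ennreal (c * \<delta> powr s)" "0 < \<delta>" for z \<delta> c
  proof -
    have "enn2real (F z \<delta>) \<le> enn2real (ennreal (max c 0 * \<delta> powr s))"
      using that by (intro enn2real_mono order.trans[OF that(1)] ennreal_leI mult_right_mono) auto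
    then show ?thesis using that(2) by (simp add: f_def field_simps)
  qed
  have bdd: "bdd_above (S \<delta>)" for \<delta>
    unfolding S_def using f_le[OF bound] by (intro bdd_aboveI[of _ "max C 0"]) auto
  have "F z \<delta> \<le> ennreal (\<omega> \<delta> * \<delta> powr s)" if z: "z \<in> K" "0 < \<delta>" "\<delta> \<le> d0" for z \<delta>
  proof -
    have "f z \<delta> \<le> \<omega> \<delta>"
      unfolding \<omega>_def using bdd z by (intro cSup_upper) (auto simp: S_def)
    then have "enn2real (F z \<delta>) \<le> \<omega> \<delta> * \<delta> powr s"
      using z by (simp add: f_def field_simps)
    moreover have "F z \<delta> < top"
      using bound[OF z] by (rule order.strict_trans1) simp
    ultimately show ?thesis by (cases "F z \<delta>") (auto intro: ennreal_leI)
  qed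
  moreover have "modulus_of_continuity \<omega>"
    unfolding modulus_of_continuity_def
  proof (intro conjI allI impI)
    show nonneg: "0 \<le> \<omega> \<delta>" for \<delta>
      unfolding \<omega>_def using bdd by (intro cSup_upper) (auto simp: S_def)
    have "S \<delta> \<subseteq> S \<delta>'" if "\<delta> \<le> \<delta>'" for \<delta> \<delta>'
      unfolding S_def using that by (intro insert_mono subsetI) (blast intro: order.trans)
    moreover have "S \<delta> \<noteq> {}" for \<delta> by (simp add: S_def)
    ultimately show "mono_on {0..} \<omega>"
      unfolding \<omega>_def using bdd by (intro mono_onI cSup_subset_mono) auto
    show "(\<omega> \<longlongrightarrow> 0) (at_right 0)"
    proof (rule tendstoI)
      fix e :: real assume "0 < e"
      then obtain \<eta> where \<eta>: "0 < \<eta>" and le: "\<And>z \<delta>. z \<in> K \<Longrightarrow> 0 < \<delta> \<Longrightarrow> \<delta> \<le> d0 \<Longrightarrow> \<delta> \<le> \<eta> \<Longrightarrow>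
          F z \<delta> \<le> ennreal (e / 2 * \<delta> powr s)"
        using small[of "e / 2"] by auto
      have "\<omega> \<delta> \<le> max (e / 2) 0" if "0 < \<delta>" "\<delta> < \<eta>" for \<delta>
        unfolding \<omega>_def using that f_le[OF le] by (intro cSup_least) (auto simp: S_def)
      then have "dist (\<omega> \<delta>) 0 < e" if "0 < \<delta>" "\<delta> < \<eta>" for \<delta>
        using that nonneg[of \<delta>] \<open>0 < e\<close> by (fastforce simp: dist_real_def)
      then show "\<forall>\<^sub>F \<delta> in at_right 0. dist (\<omega> \<delta>) 0 < e"
        using \<eta> by (auto simp: eventually_at_right_field)
    qed
  qed
  ultimately show ?thesis by blast
qed


text \<open>Both sets are Minkowski sums of a projection of \<open>K\<close> with a ball, so they are compact; they stay inside
  because the closed cylinder around each point of \<open>K\<close> does.\<close>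
lemma compact_tube:
  fixes K :: "('a::euclidean_space \<times> real) set"
  assumes K: "compact K" and "0 < \<delta>"
    and sub: "\<And>x t. (x, t) \<in> K \<Longrightarrow> compactly_contained (cylinder \<alpha> \<delta> x t) (\<Omega> \<times> I)"
  shows "\<exists>B J. compact B \<and> B \<subseteq> \<Omega> \<and> compact J \<and> J \<subseteq> I \<and>
    (\<forall>(x, t)\<in>K. cball x \<delta> \<subseteq> B \<and> {t - \<delta> powr \<alpha> .. t + \<delta> powr \<alpha>} \<subseteq> J)"
proof -
  let ?B = "{x + y |x y. x \<in> fst ` K \<and> y \<in> cball 0 \<delta>}"
  let ?J = "{x + y |x y. x \<in> snd ` K \<and> y \<in> {- (\<delta> powr \<alpha>) .. \<delta> powr \<alpha>}}"
  have cyl: "cball x \<delta> \<times> {t - \<delta> powr \<alpha> .. t + \<delta> powr \<alpha>} \<subseteq> \<Omega> \<times> I" if "(x, t) \<in> K" for x t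
    using sub[OF that] \<open>0 < \<delta>\<close>
    by (simp add: compactly_contained_def cylinder_def closure_Times)
  have comp: "compact ?B" "compact ?J"
    using K by (intro compact_sums compact_continuous_image continuous_intros; simp)+
  have B: "?B \<subseteq> \<Omega>"
  proof clarify
    fix x t and y :: 'a assume "(x, t) \<in> K" "y \<in> cball 0 \<delta>"
    then have "(x + y, t) \<in> cball x \<delta> \<times> {t - \<delta> powr \<alpha> .. t + \<delta> powr \<alpha>}"
      by (auto simp: dist_norm)
    from subsetD[OF cyl[OF \<open>(x, t) \<in> K\<close>] this] show "fst (x, t) + y \<in> \<Omega>" by simp
  qed
  have J: "?J \<subseteq> I"
  proof clarify
    fix x t and y :: real assume "(x, t) \<in> K" "y \<in> {- (\<delta> powr \<alpha>) .. \<delta> powr \<alpha>}"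
    then have "(x, t + y) \<in> cball x \<delta> \<times> {t - \<delta> powr \<alpha> .. t + \<delta> powr \<alpha>}"
      using \<open>0 < \<delta>\<close> by auto
    from subsetD[OF cyl[OF \<open>(x, t) \<in> K\<close>] this] show "snd (x, t) + y \<in> I" by simp
  qed
  have tube: "cball x \<delta> \<subseteq> ?B" "{t - \<delta> powr \<alpha> .. t + \<delta> powr \<alpha>} \<subseteq> ?J" if "(x, t) \<in> K" for x t
  proof -
    have x: "x \<in> fst ` K" and t: "t \<in> snd ` K" using that by force+
    show "cball x \<delta> \<subseteq> ?B"
    proof
      fix y assume "y \<in> cball x \<delta>"
      then have "y = x + (y - x)" "y - x \<in> cball 0 \<delta>"
        by (simp_all add: dist_norm norm_minus_commute)
      with x show "y \<in> ?B" by blast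
    qed
    show "{t - \<delta> powr \<alpha> .. t + \<delta> powr \<alpha>} \<subseteq> ?J"
    proof
      fix y assume "y \<in> {t - \<delta> powr \<alpha> .. t + \<delta> powr \<alpha>}"
      then have "y = t + (y - t)" "y - t \<in> {- (\<delta> powr \<alpha>) .. \<delta> powr \<alpha>}" by auto
      with t show "y \<in> ?J" by blast
    qed
  qed
  have all: "\<forall>(x, t)\<in>K. cball x \<delta> \<subseteq> ?B \<and> {t - \<delta> powr \<alpha> .. t + \<delta> powr \<alpha>} \<subseteq> ?J"
  proof
    fix z assume "z \<in> K"
    then have "(fst z, snd z) \<in> K" by simp
    note this[THEN tube(1)] this[THEN tube(2)]
    then show "case z of (x, t) \<Rightarrow> cball x \<delta> \<subseteq> ?B \<and> {t - \<delta> powr \<alpha> .. t + \<delta> powr \<alpha>} \<subseteq> ?J"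
      unfolding split_beta by (rule conjI)
  qed
  show ?thesis
    by (intro exI[of _ ?B] exI[of _ ?J] conjI comp B J all)
qed

text \<open>Once the norms are at most \<open>1\<close>, each of the three powers is at most the norm itself, so that smallness
  of the norms suffices.\<close>
lemma uniformly_small_powers:
  fixes u :: "'a::euclidean_space \<times> real \<Rightarrow> 'b::{real_normed_vector, second_countable_topology}"
    and p :: "'a \<times> real \<Rightarrow> 'c::{real_normed_vector, second_countable_topology}"
  assumes q: "3 \<le> q" "q < \<infinity>" and "0 < e" and "0 < \<alpha>"
    and u: "u \<in> borel_measurable (restrict_space borel X)"
    and p: "p \<in> borel_measurable (restrict_space borel X)"
    and X: "X \<in> sets borel" and B: "B \<in> sets borel" and J: "J \<in> sets borel" and BJ: "B \<times> J \<subseteq> X"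
    and fin: "mixed_norm q r J B u < \<infinity>" "mixed_norm (q / 2) (r / 2) J B p < \<infinity>"
  shows "\<exists>\<eta>>0. \<forall>t \<delta>. 0 < \<delta> \<longrightarrow> \<delta> \<le> \<eta> \<longrightarrow> {t - (2 * \<delta>) powr \<alpha> .. t + (2 * \<delta>) powr \<alpha>} \<subseteq> J \<longrightarrow>
    ennpowr (mixed_norm q r {t - (2 * \<delta>) powr \<alpha> .. t + (2 * \<delta>) powr \<alpha>} B u) 2
    + ennpowr (mixed_norm q r {t - (2 * \<delta>) powr \<alpha> .. t + (2 * \<delta>) powr \<alpha>} B u) 3
    + ennpowr (mixed_norm (q / 2) (r / 2) {t - (2 * \<delta>) powr \<alpha> .. t + (2 * \<delta>) powr \<alpha>} B p) (3 / 2)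
    \<le> ennreal e"
proof -
  define m where "m = min 1 (e / 3)"
  have m: "0 < m" "m \<le> 1" "3 * m \<le> e" using \<open>0 < e\<close> by (auto simp: m_def)
  have le: "ennpowr y k \<le> ennreal m" if "y \<le> ennreal m" "1 \<le> k" for y k
  proof -
    have "ennpowr y k \<le> ennreal (m powr k)"
      using ennpowr_mono[OF that(1), of k] that(2) m by (simp add: ennpowr_ennreal)
    also have "m powr k \<le> m powr 1" using m that(2) by (intro powr_mono') auto
    then have "ennreal (m powr k) \<le> ennreal m" using m by (intro ennreal_leI) auto
    finally show ?thesis .
  qed
  have q1: "1 \<le> q" and q2: "1 \<le> q / 2" "q / 2 < \<infinity>"
  proof -
    show "1 \<le> q" using q(1) by (rule order.trans[rotated]) simp
    have "1 \<le> ennreal (3 / 2)" by (simp flip: ennreal_1)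
    then show "1 \<le> q / 2" using half_exponent[OF q(1)] by (rule order.trans)
    show "q / 2 < \<infinity>" using q(2) by (cases q) (auto simp: ennreal_divide_numeral)
  qed
  obtain \<eta>1 where 1: "0 < \<eta>1" "\<And>I. I \<in> sets borel \<Longrightarrow> I \<subseteq> J \<Longrightarrow> emeasure lborel I \<le> ennreal \<eta>1 \<Longrightarrow>
      mixed_norm q r I B u \<le> ennreal m"
    using mixed_norm_small[OF u X B J BJ q1 q(2) fin(1) m(1)] by blast
  obtain \<eta>2 where 2: "0 < \<eta>2" "\<And>I. I \<in> sets borel \<Longrightarrow> I \<subseteq> J \<Longrightarrow> emeasure lborel I \<le> ennreal \<eta>2 \<Longrightarrow>
      mixed_norm (q / 2) (r / 2) I B p \<le> ennreal m"
    using mixed_norm_small[OF p X B J BJ q2 fin(2) m(1)] by blast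
  \<comment> \<open>This solves \<open>2 * (2 * \<eta>) powr \<alpha> = min \<eta>1 \<eta>2\<close>.\<close>
  define \<eta> where "\<eta> = min (\<eta>1 / 2) (\<eta>2 / 2) powr (1 / \<alpha>) / 2"
  have "0 < \<eta>" using 1 2 by (simp add: \<eta>_def)
  moreover have "ennpowr (mixed_norm q r I B u) 2 + ennpowr (mixed_norm q r I B u) 3
      + ennpowr (mixed_norm (q / 2) (r / 2) I B p) (3 / 2) \<le> ennreal e"
    if \<delta>: "0 < \<delta>" "\<delta> \<le> \<eta>" and I: "I = {t - (2 * \<delta>) powr \<alpha> .. t + (2 * \<delta>) powr \<alpha>}" "I \<subseteq> J" for t \<delta> I
  proof -
    have "(2 * \<delta>) powr \<alpha> \<le> (2 * \<eta>) powr \<alpha>" using \<delta> \<open>0 < \<alpha>\<close> by (intro powr_mono2) auto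
    also have "\<dots> = min (\<eta>1 / 2) (\<eta>2 / 2)"
      using 1 2 \<open>0 < \<alpha>\<close> by (simp add: \<eta>_def powr_powr)
    finally have "2 * (2 * \<delta>) powr \<alpha> \<le> \<eta>1" "2 * (2 * \<delta>) powr \<alpha> \<le> \<eta>2" by auto
    then have "emeasure lborel I \<le> ennreal \<eta>1" "emeasure lborel I \<le> ennreal \<eta>2"
      unfolding I(1) by (auto intro: ennreal_leI)
    moreover have "I \<in> sets borel" unfolding I(1) by simp
    ultimately have N: "mixed_norm q r I B u \<le> ennreal m" "mixed_norm (q / 2) (r / 2) I B p \<le> ennreal m"
      using 1 2 I(2) by auto
    have "ennpowr (mixed_norm q r I B u) 2 + ennpowr (mixed_norm q r I B u) 3
        + ennpowr (mixed_norm (q / 2) (r / 2) I B p) (3 / 2) \<le> ennreal m + ennreal m + ennreal m"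
      using N by (intro add_mono le) auto
    also have "\<dots> = ennreal (3 * m)" using m by (simp add: ennreal_plus[symmetric] del: ennreal_plus)
    also have "\<dots> \<le> ennreal e" using m by (intro ennreal_leI)
    finally show ?thesis .
  qed
  ultimately show ?thesis by blast
qed

theorem proposition4p2:
  fixes \<Omega> :: "(real^'n) set"
    and u :: "(real^'n) \<times> real \<Rightarrow> real^'n"
    and G :: "(real^'n) \<times> real \<Rightarrow> real^'n^'n"
    and p :: "(real^'n) \<times> real \<Rightarrow> real"
    and D \<mu> :: "((real^'n) \<times> real) measure"
    and K :: "((real^'n) \<times> real) set"
    and \<nu> T \<alpha> \<delta>\<^sub>0 s :: real
    and r q :: ennreal
  assumes "\<nu> > 0" and "T > 0"
    and "2 \<le> CARD('n)"
    and "open \<Omega>" and "connected \<Omega>" and "\<Omega> \<noteq> {}" and "smooth_boundary \<Omega>"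
    and "leray_hopf \<nu> T \<Omega> u G p"
    and "dissipation_measure \<nu> (\<Omega> \<times> {0<..<T}) u G p D"
    and "\<alpha> > 0" and "3 \<le> r" and "3 \<le> q"
    and "s = scaling_exponent CARD('n) \<alpha> r q"
    and "compact K" and "K \<subseteq> \<Omega> \<times> {0<..<T}"
    and "\<delta>\<^sub>0 > 0"
    and "\<forall>(x, t)\<in>K. \<forall>\<delta>. 0 < \<delta> \<and> \<delta> \<le> \<delta>\<^sub>0 \<longrightarrow>
           compactly_contained (cylinder \<alpha> \<delta> x t) (\<Omega> \<times> {0<..<T})"
    and "s \<ge> 0"
    and "in_mixed_loc q r {0<..<T} \<Omega> u"
    and "in_mixed_loc (q / 2) (r / 2) {0<..<T} \<Omega> p"
    and "\<mu> = total_dissipation \<nu> (\<Omega> \<times> {0<..<T}) G D"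
  shows "(q < \<infinity> \<longrightarrow>
            (\<exists>\<omega>. modulus_of_continuity \<omega> \<and>
               (\<forall>(x, t)\<in>K. \<forall>\<delta>. 0 < \<delta> \<and> \<delta> \<le> \<delta>\<^sub>0 / 4 \<longrightarrow>
                  emeasure \<mu> (cylinder \<alpha> \<delta> x t) \<le> ennreal (\<omega> \<delta> * \<delta> powr s)))) \<and>
         (q = \<infinity> \<longrightarrow>
            (\<exists>C::real. \<forall>(x, t)\<in>K. \<forall>\<delta>. 0 < \<delta> \<and> \<delta> \<le> \<delta>\<^sub>0 / 4 \<longrightarrow>
                  emeasure \<mu> (cylinder \<alpha> \<delta> x t) \<le> ennreal (C * \<delta> powr s))) \<and>
         (\<exists>C'::real. \<forall>(x, t)\<in>K. \<forall>\<delta>. 0 < \<delta> \<and> \<delta> \<le> \<delta>\<^sub>0 / 4 \<longrightarrow>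
            (\<integral>\<^sup>+z\<in>cylinder \<alpha> \<delta> x t. ennreal ((norm (G z))\<^sup>2) \<partial>lborel) \<le> ennreal (C' * \<delta> powr s))"
proof -
  let ?X = "\<Omega> \<times> {0<..<T}"
  let ?I = "\<lambda>t \<delta>. {t - (2 * \<delta>) powr \<alpha> .. t + (2 * \<delta>) powr \<alpha>}"
  note D = assms(9) and \<mu> = assms(21) and s = assms(13)
  have X: "?X \<in> sets borel" using \<open>open \<Omega>\<close> by (intro borel_open open_Times) auto
  have G: "in_L2 ?X G" using \<open>leray_hopf \<nu> T \<Omega> u G p\<close> by (simp add: leray_hopf_def in_L2_H1_def)
  have u: "u \<in> borel_measurable (restrict_space borel ?X)"
    using \<open>in_mixed_loc q r {0<..<T} \<Omega> u\<close> by (simp add: in_mixed_loc_def)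
  have p: "p \<in> borel_measurable (restrict_space borel ?X)"
    using \<open>in_mixed_loc (q / 2) (r / 2) {0<..<T} \<Omega> p\<close> by (simp add: in_mixed_loc_def)
  have contained: "compactly_contained (cylinder \<alpha> \<delta> x t) ?X" if "(x, t) \<in> K" "0 < \<delta>" "\<delta> \<le> \<delta>\<^sub>0" for x t \<delta>
    using assms(17) that by auto
  obtain B J where BJ: "compact B" "B \<subseteq> \<Omega>" "compact J" "J \<subseteq> {0<..<T}"
    and tube: "\<And>x t. (x, t) \<in> K \<Longrightarrow> cball x \<delta>\<^sub>0 \<subseteq> B \<and> {t - \<delta>\<^sub>0 powr \<alpha> .. t + \<delta>\<^sub>0 powr \<alpha>} \<subseteq> J"
    using compact_tube[OF \<open>compact K\<close> \<open>\<delta>\<^sub>0 > 0\<close>, of \<alpha> \<Omega> "{0<..<T}"] contained \<open>\<delta>\<^sub>0 > 0\<close>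
    by (fastforce simp: split_beta)
  have Bb: "B \<in> sets borel" and Jb: "J \<in> sets borel" and sub: "B \<times> J \<subseteq> ?X"
    using BJ by (auto simp: compact_imp_closed)
  have fin: "mixed_norm q r J B u < \<infinity>" "mixed_norm (q / 2) (r / 2) J B p < \<infinity>"
    using assms(19,20) BJ by (auto simp: in_mixed_loc_def)
  define E where "E I = ennpowr (mixed_norm q r I B u) 2 + ennpowr (mixed_norm q r I B u) 3
      + ennpowr (mixed_norm (q / 2) (r / 2) I B p) (3 / 2)" for I
  obtain C where C: "0 \<le> C" and main: "\<And>x t \<delta>. 0 < \<delta> \<Longrightarrow> \<delta> \<le> \<delta>\<^sub>0 / 4 \<Longrightarrow> cball x (2 * \<delta>) \<subseteq> B \<Longrightarrow>
      ?I t \<delta> \<subseteq> J \<Longrightarrow> emeasure \<mu> (cylinder \<alpha> \<delta> x t) \<le> ennreal (C * \<delta> powr s) * E (?I t \<delta>)"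
    using cylinder_dissipation_le[OF D X less_imp_le[OF \<open>\<nu> > 0\<close>] G u p Bb Jb sub \<open>3 \<le> r\<close> \<open>3 \<le> q\<close> \<open>\<alpha> > 0\<close> fin,
        of "\<delta>\<^sub>0 / 4"]
    unfolding \<mu> s E_def by blast
  have inside: "cball x (2 * \<delta>) \<subseteq> B" "?I t \<delta> \<subseteq> J" if "(x, t) \<in> K" "0 < \<delta>" "\<delta> \<le> \<delta>\<^sub>0 / 4" for x t \<delta>
  proof -
    have "cball x (2 * \<delta>) \<subseteq> cball x \<delta>\<^sub>0" using that by (intro subset_cball) auto
    then show "cball x (2 * \<delta>) \<subseteq> B" using tube[OF that(1)] by blast
    have "(2 * \<delta>) powr \<alpha> \<le> \<delta>\<^sub>0 powr \<alpha>" using that \<open>\<alpha> > 0\<close> by (intro powr_mono2) auto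
    then have "?I t \<delta> \<subseteq> {t - \<delta>\<^sub>0 powr \<alpha> .. t + \<delta>\<^sub>0 powr \<alpha>}" by auto
    then show "?I t \<delta> \<subseteq> J" using tube[OF that(1)] by blast
  qed
  have "E J < \<infinity>" using fin by (auto simp: E_def ennpowr_less_top)
  then obtain e0 where e0: "E J = ennreal e0" "0 \<le> e0" by (cases "E J") auto
  have E_mono: "E I \<le> ennreal e0" if "I \<in> sets borel" "I \<subseteq> J" for I
    unfolding e0(1)[symmetric] E_def
    using mixed_norm_mono[OF u X Bb Jb sub that] mixed_norm_mono[OF p X Bb Jb sub that]
    by (intro add_mono ennpowr_mono) auto
  have bound: "emeasure \<mu> (cylinder \<alpha> \<delta> x t) \<le> ennreal (C * e0 * \<delta> powr s)"
    if "(x, t) \<in> K" "0 < \<delta>" "\<delta> \<le> \<delta>\<^sub>0 / 4" for x t \<delta>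
  proof -
    have "emeasure \<mu> (cylinder \<alpha> \<delta> x t) \<le> ennreal (C * \<delta> powr s) * E (?I t \<delta>)"
      by (rule main[OF that(2,3) inside[OF that]])
    also have "\<dots> \<le> ennreal (C * \<delta> powr s) * ennreal e0"
      using inside[OF that] by (intro mult_left_mono E_mono) auto
    also have "\<dots> = ennreal (C * e0 * \<delta> powr s)" using C e0 by (simp add: ennreal_mult'[symmetric] mult_ac)
    finally show ?thesis .
  qed
  have part1: "\<exists>\<omega>. modulus_of_continuity \<omega> \<and>
      (\<forall>z\<in>K. \<forall>\<delta>. 0 < \<delta> \<and> \<delta> \<le> \<delta>\<^sub>0 / 4 \<longrightarrow>
        emeasure \<mu> (cylinder \<alpha> \<delta> (fst z) (snd z)) \<le> ennreal (\<omega> \<delta> * \<delta> powr s))" if "q < \<infinity>"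
  proof (rule modulus_of_continuity_exists[where C = "C * e0"])
    fix e :: real assume "0 < e"
    \<comment> \<open>The summand \<open>1\<close> only guards against \<open>C = 0\<close>.\<close>
    then have "0 < e / (C + 1)" using C by simp
    from uniformly_small_powers[OF \<open>3 \<le> q\<close> that this \<open>\<alpha> > 0\<close> u p X Bb Jb sub fin]
    obtain \<eta> where \<eta>: "0 < \<eta>" and small: "\<And>t \<delta>. 0 < \<delta> \<Longrightarrow> \<delta> \<le> \<eta> \<Longrightarrow> ?I t \<delta> \<subseteq> J \<Longrightarrow> E (?I t \<delta>) \<le> ennreal (e / (C + 1))"
      unfolding E_def by blast
    have "emeasure \<mu> (cylinder \<alpha> \<delta> x t) \<le> ennreal (e * \<delta> powr s)"
      if "(x, t) \<in> K" "0 < \<delta>" "\<delta> \<le> \<delta>\<^sub>0 / 4" "\<delta> \<le> \<eta>" for x t \<delta>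
    proof -
      have "emeasure \<mu> (cylinder \<alpha> \<delta> x t) \<le> ennreal (C * \<delta> powr s) * E (?I t \<delta>)"
        by (rule main[OF that(2,3) inside[OF that(1-3)]])
      also have "\<dots> \<le> ennreal (C * \<delta> powr s) * ennreal (e / (C + 1))"
        using that inside[OF that(1-3)] by (intro mult_left_mono small) auto
      also have "\<dots> = ennreal (C / (C + 1) * (e * \<delta> powr s))"
        using C \<open>0 < e\<close> by (simp add: ennreal_mult'[symmetric] mult_ac)
      also have "\<dots> \<le> ennreal (e * \<delta> powr s)"
        using C \<open>0 < e\<close> by (intro ennreal_leI mult_left_le_one_le) auto
      finally show ?thesis .
    qed
    with \<eta> show "\<exists>\<eta>>0. \<forall>z\<in>K. \<forall>\<delta>. 0 < \<delta> \<longrightarrow> \<delta> \<le> \<delta>\<^sub>0 / 4 \<longrightarrow> \<delta> \<le> \<eta> \<longrightarrow>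
        emeasure \<mu> (cylinder \<alpha> \<delta> (fst z) (snd z)) \<le> ennreal (e * \<delta> powr s)"
      by auto
  qed (use bound in auto)
  have part3: "(\<integral>\<^sup>+z\<in>cylinder \<alpha> \<delta> x t. ennreal ((norm (G z))\<^sup>2) \<partial>lborel) \<le> ennreal (C * e0 / \<nu> * \<delta> powr s)"
    if "(x, t) \<in> K" "0 < \<delta>" "\<delta> \<le> \<delta>\<^sub>0 / 4" for x t \<delta>
  proof -
    let ?Z = "cylinder \<alpha> \<delta> x t"
    have Z: "?Z \<in> sets borel" unfolding cylinder_def by (intro borel_open open_Times) auto
    have ZX: "?Z \<subseteq> ?X"
      using contained[OF that(1,2)] that(3) \<open>\<delta>\<^sub>0 > 0\<close> closure_subset[of ?Z]
      by (auto simp: compactly_contained_def)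
    have "(\<integral>\<^sup>+z\<in>?Z. ennreal ((norm (G z))\<^sup>2) \<partial>lborel)
        = (\<integral>\<^sup>+z. ennreal (1 / \<nu>) * (ennreal (\<nu> * (norm (G z))\<^sup>2) * indicator ?Z z) \<partial>lborel)"
      using \<open>\<nu> > 0\<close> by (intro nn_integral_cong) (simp add: mult.assoc[symmetric] ennreal_mult'[symmetric])
    also have "\<dots> = ennreal (1 / \<nu>) * (\<integral>\<^sup>+z\<in>?Z. ennreal (\<nu> * (norm (G z))\<^sup>2) \<partial>lborel)"
    proof (rule nn_integral_cmult)
      have [measurable]: "G \<in> borel_measurable (restrict_space borel ?X)"
        using G by (simp add: in_L2_def)
      have "(\<lambda>z. ennreal (\<nu> * (norm (G z))\<^sup>2)) \<in> borel_measurable (restrict_space borel ?X)"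
        by measurable
      from borel_measurable_indicator_on[OF this X Z ZX]
      show "(\<lambda>z. ennreal (\<nu> * (norm (G z))\<^sup>2) * indicator ?Z z) \<in> borel_measurable lborel" by simp
    qed
    also have "\<dots> \<le> ennreal (1 / \<nu>) * emeasure \<mu> ?Z"
      using D G emeasure_total_dissipation_eq[OF _ X _ Z ZX, of D G \<nu>]
      unfolding \<mu> dissipation_measure_def in_L2_def by (intro mult_left_mono) auto
    also have "\<dots> \<le> ennreal (1 / \<nu>) * ennreal (C * e0 * \<delta> powr s)"
      by (intro mult_left_mono bound that) auto
    also have "\<dots> = ennreal (C * e0 / \<nu> * \<delta> powr s)"
      using \<open>\<nu> > 0\<close> by (simp add: ennreal_mult'[symmetric])
    finally show ?thesis .
  qed
  show ?thesis
    using part1 bound part3 by (intro conjI impI) (simp add: split_beta, blast+)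
qed

end
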